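(* For $i\in\{2,3,4\}$, as formal power series in $x$, \[ \sum_{n \geq 0} J_{i,n}(z,\tau) \frac{x^n}{n!} = x\ \frac{\theta_1^\bullet(0, \tau)}{\theta_1(\frac{x}{2 \pi i},\tau)}\ \frac{ \exp(x \partial_z) \cdot \theta_i(z,\tau) }{\theta_i(z,\tau) }, \] where $\partial_z=\frac{1}{2\pi i}\frac{\partial}{\partial z}$, $\exp(x\partial_z)\cdot\theta_i(z,\tau):=\sum_{k\geq0}\frac{x^k}{k!}\partial_z^k\theta_i(z,\tau)$, and $x\,\theta_1^\bullet(0,\tau)/\theta_1(\frac{x}{2\pi i},\tau)$ is expanded as a power series in $x$.
   Context: Let $\tau\in\mathbb{H}$, $z\in\mathbb{C}$, $q=e^{2\pi i\tau}$, $p=e^{2\pi iz}$. Bernoulli numbers: $x/(e^x-1)=\sum B_nx^n/n!$. For $n\geq0$, $J_n(z,\tau) = \delta_{n,1} \frac{p}{p - 1} + B_n - n \sum_{k, r \geq 1} r^{n - 1} (p^k + (-1)^n p^{-k}) q^{k r}$ (meromorphically continued in $z$). For $n\geq 0$ define $J_{2,n}(z,\tau) = 2 J_n(2z, 2\tau) - J_n(z, \tau)$, $J_{3,n}(z,\tau) = 2^{2-n} J_n(2z, \tau) - 2 J_n(2z,2\tau) + J_n(z, \tau) - 2^{1 - n} J_n(z, \tau/2)$, $J_{4,n}(z,\tau) = 2^{1-n} J_n(z, \tau/2) - J_n(z, \tau)$. Let $\theta_1(z,\tau) = -i q^{1/8} (p^{1/2} - p^{-1/2}) \prod_{m \geq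 1} (1 - q^m) (1 - p q^m) (1 - p^{-1} q^m)$, $\theta_1^\bullet=\partial_z\theta_1$, and $\theta_2(z,\tau) = \theta_1(z + \frac{1}{2}, \tau)$, $\theta_3(z,\tau) = q^{1/8} p^{1/2} \theta_1(z + \frac{1}{2} \tau + \frac{1}{2}, \tau)$, $\theta_4(z,\tau) = \theta_3(z + \frac12, \tau)$. *)

theory Defs
  imports "HOL-Complex_Analysis.Complex_Analysis"
begin

text \<open>
  Throughout, \<open>q = nome \<tau> = e\<^bsup>2\<pi>i\<tau>\<^esup>\<close> and \<open>p = nome z = e\<^bsup>2\<pi>iz\<^esup>\<close>. The fractional powers
  \<open>p\<^bsup>1/2\<^esup>\<close> and \<open>q\<^bsup>1/8\<^esup>\<close> are the entire functions \<open>e\<^bsup>\<pi>iz\<^esup>\<close> and \<open>e\<^bsup>\<pi>i\<tau>/4\<^esup>\<close>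
  of \<open>z\<close> and \<open>\<tau>\<close>, not principal branches applied to \<open>p\<close> and \<open>q\<close>.
\<close>

definition nome :: "complex \<Rightarrow> complex" where
  "nome t = exp (2 * of_real pi * \<i> * t)"

definition nome_root :: "nat \<Rightarrow> complex \<Rightarrow> complex" where
  "nome_root m t = exp (2 * of_real pi * \<i> * t / of_nat m)"

definition bernoulli_number :: "nat \<Rightarrow> complex" where
  "bernoulli_number n = fact n * fps_nth (fps_X / (fps_exp 1 - 1)) n"

text \<open>
  The defining series of \<open>J\<^sub>n\<close>, as an (unordered) double sum over \<open>k, r \<ge> 1\<close>. It converges
  absolutely for \<open>\<bar>Im z\<bar> < Im \<tau>\<close>; for \<open>n = 1\<close> the extra term has its poles at the integers.
\<close>

definition J_series :: "nat \<Rightarrow> complex \<Rightarrow> complex \<Rightarrow> complex" where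
  "J_series n z \<tau> =
     (if n = 1 then nome z / (nome z - 1) else 0) + bernoulli_number n
     - of_nat n * (\<Sum>\<^sub>\<infinity>(k, r)\<in>{1::nat..} \<times> {1::nat..}.
         of_nat r powi (int n - 1)
         * (nome z ^ k + (-1) ^ n * nome z powi (- int k)) * nome \<tau> ^ (k * r))"

text \<open>
  The meromorphic continuation in \<open>z\<close> to the whole plane. It is unique as a function because
  \<open>nicely_meromorphic_on\<close> normalises its value at each pole to \<open>0\<close> and requires continuity elsewhere.
\<close>

definition J :: "nat \<Rightarrow> complex \<Rightarrow> complex \<Rightarrow> complex" where
  "J n z \<tau> =
     (THE f. f nicely_meromorphic_on UNIV \<and>
             (\<forall>w. \<bar>Im w\<bar> < Im \<tau> \<and> w \<notin> \<int> \<longrightarrow> f w = J_series n w \<tau>)) z"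

text \<open>
  The combinations below are taken as meromorphic functions of \<open>z\<close>: the individual terms have
  poles that cancel in the sum (for instance at \<open>z = 0\<close> when \<open>n = 1\<close>), so the pointwise
  combination is passed through \<open>remove_sings\<close>.
\<close>

definition J2 :: "nat \<Rightarrow> complex \<Rightarrow> complex \<Rightarrow> complex" where
  "J2 n z \<tau> = remove_sings (\<lambda>w. 2 * J n (2 * w) (2 * \<tau>) - J n w \<tau>) z"

definition J3 :: "nat \<Rightarrow> complex \<Rightarrow> complex \<Rightarrow> complex" where
  "J3 n z \<tau> = remove_sings (\<lambda>w.
     2 powi (2 - int n) * J n (2 * w) \<tau> - 2 * J n (2 * w) (2 * \<tau>)
     + J n w \<tau> - 2 powi (1 - int n) * J n w (\<tau> / 2)) z"

definition J4 :: "nat \<Rightarrow> complex \<Rightarrow> complex \<Rightarrow> complex" where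
  "J4 n z \<tau> = remove_sings (\<lambda>w. 2 powi (1 - int n) * J n w (\<tau> / 2) - J n w \<tau>) z"

text \<open>The product over \<open>m \<ge> 1\<close> is indexed from \<open>0\<close>, hence the exponents \<open>Suc m\<close>.\<close>

definition theta1 :: "complex \<Rightarrow> complex \<Rightarrow> complex" where
  "theta1 z \<tau> =
     - \<i> * nome_root 8 \<tau> * (nome_root 2 z - inverse (nome_root 2 z))
     * (\<Prod>m. (1 - nome \<tau> ^ Suc m) * (1 - nome z * nome \<tau> ^ Suc m)
             * (1 - inverse (nome z) * nome \<tau> ^ Suc m))"

definition theta2 :: "complex \<Rightarrow> complex \<Rightarrow> complex" where
  "theta2 z \<tau> = theta1 (z + 1 / 2) \<tau>"

definition theta3 :: "complex \<Rightarrow> complex \<Rightarrow> complex" where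
  "theta3 z \<tau> = nome_root 8 \<tau> * nome_root 2 z * theta1 (z + \<tau> / 2 + 1 / 2) \<tau>"

definition theta4 :: "complex \<Rightarrow> complex \<Rightarrow> complex" where
  "theta4 z \<tau> = theta3 (z + 1 / 2) \<tau>"

text \<open>Families indexed by \<open>i \<in> {2, 3, 4}\<close>; the value \<open>0\<close> for other \<open>i\<close> is a dummy.\<close>

definition J_sub :: "nat \<Rightarrow> nat \<Rightarrow> complex \<Rightarrow> complex \<Rightarrow> complex" where
  "J_sub i n z \<tau> =
     (if i = 2 then J2 n z \<tau> else if i = 3 then J3 n z \<tau> else if i = 4 then J4 n z \<tau> else 0)"

definition theta :: "nat \<Rightarrow> complex \<Rightarrow> complex \<Rightarrow> complex" where
  "theta i z \<tau> =
     (if i = 2 then theta2 z \<tau> else if i = 3 then theta3 z \<tau>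
      else if i = 4 then theta4 z \<tau> else 0)"

text \<open>The normalised derivative \<open>\<partial>\<^sub>z = (2\<pi>i)\<^bsup>-1\<^esup> d/dz\<close>.\<close>

definition dz :: "(complex \<Rightarrow> complex) \<Rightarrow> complex \<Rightarrow> complex" where
  "dz f = (\<lambda>z. deriv f z / (2 * of_real pi * \<i>))"

definition theta1_bullet :: "complex \<Rightarrow> complex \<Rightarrow> complex" where
  "theta1_bullet z \<tau> = dz (\<lambda>w. theta1 w \<tau>) z"

definition exp_x_dz :: "(complex \<Rightarrow> complex) \<Rightarrow> complex \<Rightarrow> complex fps" where
  "exp_x_dz f z = Abs_fps (\<lambda>k. (dz ^^ k) f z / fact k)"

text \<open>
  Both numerator and denominator vanish to order exactly one at \<open>x = 0\<close>, so this division of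
  formal power series is exact.
\<close>

definition theta1_prefactor :: "complex \<Rightarrow> complex fps" where
  "theta1_prefactor \<tau> =
     fps_X * fps_const (theta1_bullet 0 \<tau>)
     / fps_expansion (\<lambda>x. theta1 (x / (2 * of_real pi * \<i>)) \<tau>) 0"

end

theory Submission
  imports Defs
begin

text \<open>
  With \<open>y = e\<^bsup>x\<^esup>\<close>, \<open>p = nome z\<close> and \<open>q = nome \<tau>\<close>, expanding the double series of \<open>J\<^sub>n\<close> in \<open>x\<close>
  shows that \<open>\<Sum> J\<^sub>n x\<^bsup>n\<^esup>/n!\<close> equals \<open>x\<close> times Kronecker's function
  \<open>1/(y - 1) + p/(p - 1) - \<Sum> (p\<^bsup>k\<^esup> y\<^bsup>r\<^esup> - p\<^bsup>-k\<^esup> y\<^bsup>-r\<^esup>) q\<^bsup>kr\<^esup>\<close> as long as \<open>\<bar>Im z\<bar> < Im \<tau>\<close>. By Liouville's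
  theorem Kronecker's function is \<open>\<theta>\<^sub>1\<^sup>\<bullet>(0) \<theta>\<^sub>1(\<xi> + z) / (\<theta>\<^sub>1(\<xi>) \<theta>\<^sub>1(z))\<close> with \<open>x = 2\<pi>i\<xi>\<close>: both sides have
  the same poles, residues and multipliers in \<open>\<xi>\<close>. The coefficients of the theta quotient are
  meromorphic in \<open>z\<close>, so they are the continuations of the \<open>J\<^sub>n\<close>. The \<open>J\<close>-combinations for
  \<open>i = 2, 3, 4\<close> are Kronecker's function at \<open>z\<close> shifted by half periods, which is checked termwise
  for \<open>z\<close> in a strip and extends to all \<open>z\<close> by the identity theorem.
\<close>

section \<open>The Jacobi theta function\<close>

definition qpoch :: "complex \<Rightarrow> complex \<Rightarrow> complex" where
  "qpoch q x = (\<Prod>n. 1 - x * q ^ n)"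

lemma convergent_prod_qpoch:
  fixes q x :: complex
  assumes "norm q < 1"
  shows "convergent_prod (\<lambda>n. 1 - x * q ^ n)"
proof -
  have "summable (\<lambda>n. norm x * norm q ^ n)"
    using assms by (intro summable_mult summable_geometric) auto
  hence "summable (\<lambda>n. norm (- (x * q ^ n)))"
    by (simp only: norm_minus_cancel norm_mult norm_power)
  thus ?thesis
    by (intro abs_convergent_prod_imp_convergent_prod) (simp add: abs_convergent_prod_conv_summable)
qed

lemma qpoch_tendsto:
  assumes "norm q < 1"
  shows "(\<lambda>N. \<Prod>n<N. 1 - x * q ^ n) \<longlonglongrightarrow> qpoch q x"
  using convergent_prod_LIMSEQ[OF convergent_prod_qpoch[OF assms]]
  unfolding qpoch_def LIMSEQ_lessThan_iff_atMost by simp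

text \<open>Near \<open>x\<close> the factors differ from 1 by at most
  \<open>(norm x + 1) * norm q ^ n\<close>, so the partial products converge uniformly on a closed
  disc and their holomorphy passes to the limit.\<close>

lemma qpoch_holomorphic:
  assumes q: "norm q < 1"
  shows "qpoch q holomorphic_on UNIV"
proof (rule holomorphic_uniform_sequence[where f = "\<lambda>N x. \<Prod>n<N. 1 - x * q ^ n"])
  fix x :: complex
  have "uniformly_convergent_on (cball x 1) (\<lambda>N x. \<Prod>n<N. 1 - x * q ^ n)"
  proof (rule uniformly_convergent_on_prod')
    show "uniformly_convergent_on (cball x 1) (\<lambda>N y. \<Sum>n<N. norm (1 - y * q ^ n - 1))"
    proof (rule Weierstrass_m_test')
      show "summable (\<lambda>n. (norm x + 1) * norm q ^ n)"
        using q by (intro summable_mult summable_geometric) auto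
      fix n y assume "y \<in> cball x 1"
      hence "norm y \<le> norm x + 1"
        using norm_triangle_ineq4[of y x] norm_triangle_ineq2[of y x]
        by (simp add: dist_norm norm_minus_commute)
      thus "norm (norm (1 - y * q ^ n - 1)) \<le> (norm x + 1) * norm q ^ n"
        by (simp add: norm_mult norm_power mult_right_mono)
    qed
  qed (auto intro!: continuous_intros)
  then obtain l where l: "uniform_limit (cball x 1) (\<lambda>N x. \<Prod>n<N. 1 - x * q ^ n) l sequentially"
    by (auto simp: uniformly_convergent_on_def)
  have "l y = qpoch q y" if "y \<in> cball x 1" for y
    using tendsto_uniform_limitI[OF l that] qpoch_tendsto[OF q] LIMSEQ_unique by blast
  hence "uniform_limit (cball x 1) (\<lambda>N x. \<Prod>n<N. 1 - x * q ^ n) (qpoch q) sequentially"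
    using l by (metis (no_types, lifting) uniform_limit_cong')
  thus "\<exists>d>0. cball x d \<subseteq> UNIV \<and>
          uniform_limit (cball x d) (\<lambda>N x. \<Prod>n<N. 1 - x * q ^ n) (qpoch q) sequentially"
    by (intro exI[of _ 1]) auto
qed (auto intro!: holomorphic_intros)

lemma qpoch_shift:
  assumes "norm q < 1"
  shows "qpoch q x = (1 - x) * qpoch q (x * q)"
proof -
  have "(\<lambda>N. \<Prod>n<Suc N. 1 - x * q ^ n) \<longlonglongrightarrow> qpoch q x"
    using qpoch_tendsto[OF assms] by (rule LIMSEQ_Suc)
  moreover have "(\<Prod>n<Suc N. 1 - x * q ^ n) = (1 - x) * (\<Prod>n<N. 1 - x * q * q ^ n)" for N
    by (subst prod.lessThan_Suc_shift) (simp add: mult.assoc)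
  moreover have "(\<lambda>N. (1 - x) * (\<Prod>n<N. 1 - x * q * q ^ n)) \<longlonglongrightarrow> (1 - x) * qpoch q (x * q)"
    using qpoch_tendsto[OF assms] by (intro tendsto_intros)
  ultimately show ?thesis
    by (simp only:) (rule LIMSEQ_unique)
qed

lemma qpoch_nonzero:
  assumes "norm q < 1" "\<And>n. x * q ^ n \<noteq> 1"
  shows "qpoch q x \<noteq> 0"
  unfolding qpoch_def
  by (rule prodinf_nonzero[OF convergent_prod_qpoch[OF assms(1)]]) (use assms(2) in \<open>metis eq_iff_diff_eq_0\<close>)

section \<open>The exponential parametrisation by \<open>nome\<close>\<close>

lemma nome_nonzero [simp]: "nome z \<noteq> 0" and nome_root_nonzero [simp]: "nome_root m z \<noteq> 0"
  by (simp_all add: nome_def nome_root_def)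

lemma nome_add: "nome (z + w) = nome z * nome w"
  by (simp add: nome_def exp_add ring_distribs)

lemma nome_0 [simp]: "nome 0 = 1" and nome_1 [simp]: "nome 1 = 1"
  by (simp_all add: nome_def)

lemma nome_minus: "nome (- z) = inverse (nome z)"
  by (simp add: nome_def exp_minus)

lemma nome_diff: "nome (z - w) = nome z / nome w"
  using nome_add[of z "-w"] by (simp add: nome_minus field_simps)

lemma nome_half [simp]: "nome (1 / 2) = -1"
  by (simp add: nome_def)

lemma nome_of_nat_mult: "nome (of_nat n * z) = nome z ^ n"
  by (simp add: nome_def exp_of_nat_mult [symmetric] mult_ac)

lemma nome_double: "nome (2 * z) = nome z ^ 2"
  using nome_of_nat_mult[of 2 z] by simp

lemma norm_nome: "norm (nome z) = exp (- 2 * pi * Im z)"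
  by (simp add: nome_def)

lemma norm_nome_less_1: "Im z > 0 \<Longrightarrow> norm (nome z) < 1"
  by (simp add: norm_nome)

lemma nome_eq_1_iff: "nome z = 1 \<longleftrightarrow> z \<in> \<int>"
proof -
  have "nome z = 1 \<longleftrightarrow> (\<exists>n::int. 2 * pi * Re z = of_int (2 * n) * pi \<and> Im z = 0)"
    by (auto simp: nome_def exp_eq_1)
  also have "\<dots> \<longleftrightarrow> z \<in> \<int>"
    by (auto simp: Ints_def complex_eq_iff)
  finally show ?thesis .
qed

lemma nome_holomorphic [holomorphic_intros]:
  "f holomorphic_on A \<Longrightarrow> (\<lambda>z. nome (f z)) holomorphic_on A"
  unfolding nome_def by (intro holomorphic_intros)

lemma nome_root_holomorphic [holomorphic_intros]:
  "f holomorphic_on A \<Longrightarrow> (\<lambda>z. nome_root m (f z)) holomorphic_on A"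
  unfolding nome_root_def by (cases "m = 0") (auto intro!: holomorphic_intros)

lemma nome_root_2_square: "nome_root 2 z ^ 2 = nome z"
  by (simp add: nome_root_def nome_def exp_double [symmetric] mult_ac)

lemma nome_root_add: "nome_root m (z + w) = nome_root m z * nome_root m w"
  by (simp add: nome_root_def exp_add ring_distribs add_divide_distrib)

lemma nome_root_2_1: "nome_root 2 1 = -1"
  by (simp add: nome_root_def)

text \<open>The factor \<open>p^(1/2) - p^(-1/2)\<close> equals \<open>- p^(-1/2) * (1 - p)\<close>,
  and \<open>1 - p\<close> is the factor of exponent 0 missing from the product over
  \<open>1 - p * q ^ Suc m\<close>. All zeros in \<open>z\<close> now sit in the last two
  \<open>qpoch\<close> factors.\<close>

lemma theta1_conv_qpoch:
  assumes "Im \<tau> > 0"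
  shows "theta1 z \<tau> = \<i> * nome_root 8 \<tau> * inverse (nome_root 2 z) *
           qpoch (nome \<tau>) (nome \<tau>) * qpoch (nome \<tau>) (nome z) *
           qpoch (nome \<tau>) (inverse (nome z) * nome \<tau>)"
proof -
  define p q where "p = nome z" and "q = nome \<tau>"
  have q: "norm q < 1"
    using norm_nome_less_1[OF assms] by (simp add: q_def)
  have conv: "convergent_prod (\<lambda>m. 1 - x * q * q ^ m)" for x
    by (rule convergent_prod_qpoch[OF q])
  have "(\<Prod>m. (1 - q ^ Suc m) * (1 - p * q ^ Suc m) * (1 - inverse p * q ^ Suc m)) =
        qpoch q q * qpoch q (p * q) * qpoch q (inverse p * q)"
    using conv[of 1] conv[of p] conv[of "inverse p"]
    by (simp add: qpoch_def prodinf_mult convergent_prod_mult mult.assoc [symmetric])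
  moreover have "nome_root 2 z - inverse (nome_root 2 z) = - inverse (nome_root 2 z) * (1 - p)"
    using nome_root_2_square[of z] by (simp add: field_simps power2_eq_square p_def)
  ultimately show ?thesis
    using qpoch_shift[OF q, of p]
    unfolding theta1_def p_def [symmetric] q_def [symmetric] by simp
qed

lemma theta1_holomorphic:
  assumes "Im \<tau> > 0"
  shows "(\<lambda>z. theta1 z \<tau>) holomorphic_on UNIV"
proof -
  have q: "norm (nome \<tau>) < 1"
    using norm_nome_less_1[OF assms] .
  have *: "(\<lambda>z. qpoch (nome \<tau>) (f z)) holomorphic_on UNIV" if "f holomorphic_on UNIV" for f
    using holomorphic_on_compose_gen[OF that qpoch_holomorphic[OF q]] by (simp add: o_def)
  show ?thesis
    unfolding theta1_conv_qpoch[OF assms] by (intro holomorphic_intros *) auto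
qed

lemma theta1_add_1: "theta1 (z + 1) \<tau> = - theta1 z \<tau>"
  by (simp add: theta1_def nome_add nome_root_add nome_root_2_1)
    (simp add: algebra_simps)

text \<open>As \<open>p\<close> becomes \<open>p * q\<close>, one product loses \<open>1 - p\<close>
  and the other gains \<open>1 - inverse p = - inverse p * (1 - p)\<close>. Nothing is divided by
  \<open>1 - p\<close>, so the points with \<open>p = 1\<close> are covered.\<close>

lemma theta1_add_tau:
  assumes "Im \<tau> > 0"
  shows "theta1 (z + \<tau>) \<tau> = - inverse (nome_root 2 \<tau> * nome z) * theta1 z \<tau>"
proof -
  define p q where "p = nome z" and "q = nome \<tau>"
  have q: "norm q < 1"
    using norm_nome_less_1[OF assms] by (simp add: q_def)
  have nz: "p \<noteq> 0" "q \<noteq> 0"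
    by (simp_all add: p_def q_def)
  have 1: "qpoch q p = (1 - p) * qpoch q (p * q)"
    by (rule qpoch_shift[OF q])
  have 2: "qpoch q (inverse p) = (1 - inverse p) * qpoch q (inverse p * q)"
    by (rule qpoch_shift[OF q])
  have "theta1 (z + \<tau>) \<tau> = \<i> * nome_root 8 \<tau> * inverse (nome_root 2 z * nome_root 2 \<tau>) *
           qpoch q q * qpoch q (p * q) * qpoch q (inverse p)"
    using nz unfolding theta1_conv_qpoch[OF assms] nome_add nome_root_add p_def q_def
    by (simp add: mult.assoc)
  also have "\<dots> = - inverse (nome_root 2 \<tau> * p) * (\<i> * nome_root 8 \<tau> * inverse (nome_root 2 z) *
           qpoch q q * qpoch q p * qpoch q (inverse p * q))"
    using nz unfolding 1 2 by (simp add: field_simps)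
  finally show ?thesis
    unfolding theta1_conv_qpoch[OF assms] p_def q_def .
qed

lemma theta1_0 [simp]: "theta1 0 \<tau> = 0"
  by (simp add: theta1_def nome_root_def)

lemma nome_power_ne_1:
  assumes "Im \<tau> > 0"
  shows "nome \<tau> ^ Suc n \<noteq> 1"
proof -
  have "norm (nome \<tau>) ^ Suc n < 1"
    using norm_nome_less_1[OF assms] by (intro power_Suc_less_one) auto
  thus ?thesis by (metis norm_one norm_power order_less_irrefl)
qed

text \<open>A pair of natural exponents stands for the integer exponent \<open>n - m\<close>: the
  hypothesis keeps \<open>z\<close> off the lattice generated by \<open>1\<close> and
  \<open>\<tau>\<close>, where no factor of the product vanishes.\<close>

lemma theta1_nonzero:
  assumes "Im \<tau> > 0" "\<And>m n. nome z * nome \<tau> ^ m \<noteq> nome \<tau> ^ n"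
  shows "theta1 z \<tau> \<noteq> 0"
proof -
  have q: "norm (nome \<tau>) < 1"
    using norm_nome_less_1[OF assms(1)] .
  have nz: "nome z * nome \<tau> ^ m \<noteq> nome \<tau> ^ n" for m n
    using assms(2) .
  have "inverse (nome z) * nome \<tau> * nome \<tau> ^ n \<noteq> 1" for n
    using nz[of 0 "Suc n"] by (auto simp: field_simps)
  moreover have "nome \<tau> * nome \<tau> ^ n \<noteq> 1" for n
    using nome_power_ne_1[OF assms(1), of n] by simp
  moreover have "nome z * nome \<tau> ^ n \<noteq> 1" for n
    using nz[of n 0] by simp
  ultimately show ?thesis
    unfolding theta1_conv_qpoch[OF assms(1)] by (simp add: qpoch_nonzero[OF q])
qed

text \<open>The multiplier under \<open>z + \<tau>\<close> never vanishes, so a zero can be moved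
  along multiples of \<open>\<tau>\<close>. A lattice point is thereby moved to one with
  \<open>nome w = 1\<close>, where the first factor of \<open>qpoch\<close> is zero.\<close>

lemma theta1_nonzeroD:
  assumes "Im \<tau> > 0" "theta1 z \<tau> \<noteq> 0"
  shows "nome z * nome \<tau> ^ m \<noteq> nome \<tau> ^ n"
proof
  assume eq: "nome z * nome \<tau> ^ m = nome \<tau> ^ n"
  have tau: "theta1 (w + of_nat k * \<tau>) \<tau> = 0 \<longleftrightarrow> theta1 w \<tau> = 0" for w k
  proof (induction k)
    case (Suc k)
    have *: "w + of_nat (Suc k) * \<tau> = (w + of_nat k * \<tau>) + \<tau>"
      by (simp add: algebra_simps)
    thus ?case
      unfolding * theta1_add_tau[OF assms(1)] using Suc by simp
  qed simp
  define w where "w = z + of_nat m * \<tau> - of_nat n * \<tau>"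
  have "nome w = 1"
    using eq by (simp add: w_def nome_add nome_diff nome_of_nat_mult)
  moreover have "qpoch (nome \<tau>) 1 = 0"
    using qpoch_shift[OF norm_nome_less_1[OF assms(1)], of 1] by simp
  ultimately have "theta1 w \<tau> = 0"
    by (simp add: theta1_conv_qpoch[OF assms(1)])
  hence "theta1 (w + of_nat n * \<tau>) \<tau> = 0"
    by (simp only: tau)
  hence "theta1 (z + of_nat m * \<tau>) \<tau> = 0"
    by (simp add: w_def)
  hence "theta1 z \<tau> = 0"
    by (simp only: tau)
  thus False
    using assms(2) by simp
qed

text \<open>Splitting off \<open>1 - nome z\<close> leaves a cofactor \<open>h\<close> that is
  nonzero at 0, so the zero is simple.\<close>

lemma deriv_theta1_0_nonzero:
  assumes "Im \<tau> > 0"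
  shows "deriv (\<lambda>z. theta1 z \<tau>) 0 \<noteq> 0"
proof -
  define q where "q = nome \<tau>"
  have q: "norm q < 1"
    using norm_nome_less_1[OF assms] by (simp add: q_def)
  define h where "h = (\<lambda>z. \<i> * nome_root 8 \<tau> * inverse (nome_root 2 z) * qpoch q q *
                       qpoch q (nome z * q) * qpoch q (inverse (nome z) * q))"
  have *: "(\<lambda>z. qpoch q (f z)) holomorphic_on UNIV" if "f holomorphic_on UNIV" for f
    using holomorphic_on_compose_gen[OF that qpoch_holomorphic[OF q]] by (simp add: o_def)
  have "h holomorphic_on UNIV"
    unfolding h_def by (intro holomorphic_intros *) auto
  hence "(h has_field_derivative deriv h 0) (at 0)"
    by (intro holomorphic_derivI[of _ UNIV]) auto
  moreover have "((\<lambda>z. 1 - nome z) has_field_derivative - (2 * of_real pi * \<i>)) (at 0)"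
    unfolding nome_def by (auto intro!: derivative_eq_intros)
  ultimately have "((\<lambda>z. (1 - nome z) * h z) has_field_derivative - (2 * of_real pi * \<i>) * h 0) (at 0)"
    using DERIV_mult by fastforce
  moreover have "(\<lambda>z. (1 - nome z) * h z) = (\<lambda>z. theta1 z \<tau>)"
    unfolding h_def theta1_conv_qpoch[OF assms] q_def [symmetric]
    by (subst (3) qpoch_shift[OF q]) (simp add: mult_ac)
  moreover have "qpoch q q \<noteq> 0"
    using nome_power_ne_1[OF assms] by (intro qpoch_nonzero[OF q]) (simp add: q_def)
  ultimately show ?thesis
    by (simp add: DERIV_imp_deriv h_def)
qed

section \<open>Lambert series and Kronecker's function\<close>

lemma doubly_periodic_norm_bounded:
  fixes f :: "complex \<Rightarrow> complex"
  assumes "continuous_on UNIV f" "Im \<tau> > 0"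
    and per1: "\<And>x. norm (f (x + 1)) = norm (f x)"
    and pertau: "\<And>x. norm (f (x + \<tau>)) = norm (f x)"
  shows "bounded (range f)"
proof -
  have 1: "norm (f (x + of_int n)) = norm (f x)" for x n
  proof (induction n rule: int_induct[where k = 0])
    case (step1 i)
    thus ?case using per1[of "x + of_int i"] by (simp add: add.assoc)
  next
    case (step2 i)
    thus ?case using per1[of "x + of_int (i - 1)"] by (simp add: add.assoc)
  qed simp
  have 2: "norm (f (x + of_int n * \<tau>)) = norm (f x)" for x n
  proof (induction n rule: int_induct[where k = 0])
    case (step1 i)
    thus ?case using pertau[of "x + of_int i * \<tau>"] by (simp add: algebra_simps)
  next
    case (step2 i)
    thus ?case using pertau[of "x + of_int (i - 1) * \<tau>"] by (simp add: algebra_simps)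
  qed simp
  define P where "P = (\<lambda>(s :: real, t :: real). of_real s + of_real t * \<tau>) ` ({0..1} \<times> {0..1})"
  have "compact P"
    unfolding P_def
    by (intro compact_continuous_image compact_Times) (auto intro!: continuous_intros simp: case_prod_unfold)
  hence "bounded (f ` P)"
    using assms(1) by (intro compact_imp_bounded compact_continuous_image) (auto intro: continuous_on_subset)
  then obtain B where B: "\<And>x. x \<in> P \<Longrightarrow> norm (f x) \<le> B"
    by (auto simp: bounded_iff)
  have "norm (f x) \<le> B" for x
  proof -
    \<comment> \<open>Here \<open>s\<close> and \<open>t\<close> are the real coordinates with
      respect to \<open>1\<close> and \<open>\<tau>\<close>; dropping their integer parts moves
      \<open>x\<close> into the compact parallelogram \<open>P\<close>.\<close>
    define t where "t = Im x / Im \<tau>"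
    define s where "s = Re x - t * Re \<tau>"
    have x: "x = of_real s + of_real t * \<tau>"
      using assms(2) by (simp add: complex_eq_iff s_def t_def)
    have "of_real (frac s) + of_real (frac t) * \<tau> \<in> P"
      unfolding P_def by (rule image_eqI[of _ _ "(frac s, frac t)"]) (auto intro: less_imp_le frac_lt_1)
    hence "norm (f (of_real (frac s) + of_real (frac t) * \<tau>)) \<le> B"
      by (rule B)
    moreover have "x = (of_real (frac s) + of_real (frac t) * \<tau>) + of_int \<lfloor>s\<rfloor> + of_int \<lfloor>t\<rfloor> * \<tau>"
      by (subst x) (simp add: frac_def algebra_simps)
    ultimately show ?thesis
      by (metis 1 2)
  qed
  thus ?thesis
    by (auto simp: bounded_iff)
qed

text \<open>
  A suitable exponential factor turns \<open>f\<close> into a function of doubly periodic modulus,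
  which is constant by Liouville's theorem.
\<close>

lemma quasi_periodic_entire_eq_0:
  assumes hol: "f holomorphic_on UNIV" and tau: "Im \<tau> > 0"
    and per1: "\<And>x. f (x + 1) = f x" and pertau: "\<And>x. f (x + \<tau>) = c * f x"
    and c: "c \<noteq> 0" "\<And>n :: int. c \<noteq> nome (of_int n * \<tau>)"
  shows "f x = 0"
proof -
  \<comment> \<open>As \<open>b\<close> is real, the exponential factor keeps its modulus under
    \<open>x + 1\<close>. Its value is chosen so that the modulus changes by
    \<open>inverse (norm c)\<close> under \<open>x + \<tau>\<close>, which cancels that of
    \<open>c\<close>.\<close>
  define b where "b = - ln (norm c) / (2 * pi * Im \<tau>)"
  define g where "g = (\<lambda>x. nome (- of_real b * x) * f x)"
  have hol': "g holomorphic_on UNIV"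
    unfolding g_def by (intro holomorphic_intros hol)
  have "bounded (range g)"
  proof (rule doubly_periodic_norm_bounded[OF _ tau])
    show "continuous_on UNIV g"
      using hol' by (rule holomorphic_on_imp_continuous_on)
    show "norm (g (x + 1)) = norm (g x)" for x
      by (simp add: g_def per1 norm_mult norm_nome)
    show "norm (g (x + \<tau>)) = norm (g x)" for x
    proof -
      have "exp (2 * pi * (b * Im \<tau>)) = inverse (norm c)"
        using tau c(1) by (simp add: b_def exp_minus)
      thus ?thesis
        using c(1) by (simp add: g_def pertau norm_mult norm_nome ring_distribs exp_add)
    qed
  qed
  with hol' have "g constant_on UNIV"
    using Liouville_theorem by (metis constant_on_def)
  then obtain a where a: "\<And>x. g x = a"
    by (auto simp: constant_on_def)
  have f: "f x = a * nome (of_real b * x)" for x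
    using a[of x] by (simp add: g_def nome_minus field_simps)
  \<comment> \<open>A nonzero constant would, by the period 1, force \<open>b\<close> to be an
    integer, and then \<open>c\<close> would be one of the excluded powers of
    \<open>nome \<tau>\<close>.\<close>
  have "a = 0"
  proof (rule ccontr)
    assume "a \<noteq> 0"
    hence "nome (of_real b) = 1"
      using per1[of 0] by (simp add: f)
    then obtain n :: int where n: "complex_of_real b = of_int n"
      by (auto simp: nome_eq_1_iff elim: Ints_cases)
    have "nome (of_int n * \<tau>) = c"
      using pertau[of 0] \<open>a \<noteq> 0\<close> by (simp add: f n)
    thus False
      using c(2) by metis
  qed
  thus ?thesis
    by (simp add: f)
qed

text \<open>This is the double sum of \<open>p ^ k * y ^ r * q ^ (k * r)\<close> over
  \<open>k, r \<ge> 1\<close> after the geometric summation over \<open>r\<close>. The summed form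
  makes sense for every \<open>y\<close> off the poles \<open>y * q ^ k = 1\<close>, whereas the
  geometric series need \<open>norm (y * q) < 1\<close>.\<close>

definition lambert :: "complex \<Rightarrow> complex \<Rightarrow> complex \<Rightarrow> complex" where
  "lambert q p y = (\<Sum>k. p ^ Suc k * (y * q ^ Suc k) / (1 - y * q ^ Suc k))"

text \<open>Once \<open>R * norm q ^ Suc k < 1 / 2\<close>, the denominators have modulus at least
  \<open>1 / 2\<close> on the whole disc. The bound is only eventual because finitely many early
  terms may have poles there.\<close>

lemma lambert_term_bound:
  fixes q p :: complex
  assumes "norm q < 1"
  shows "\<forall>\<^sub>F k in sequentially. \<forall>y\<in>cball 0 R.
           norm (p ^ Suc k * (y * q ^ Suc k) / (1 - y * q ^ Suc k)) \<le> 2 * R * norm (p * q) ^ Suc k"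
proof -
  have "(\<lambda>k. R * norm q ^ Suc k) \<longlonglongrightarrow> R * 0"
    using assms by (intro tendsto_intros LIMSEQ_Suc LIMSEQ_power_zero) auto
  hence "\<forall>\<^sub>F k in sequentially. R * norm q ^ Suc k < 1 / 2"
    by (rule order_tendstoD) auto
  thus ?thesis
  proof eventually_elim
    case (elim k)
    show ?case
    proof
      fix y :: complex assume y: "y \<in> cball 0 R"
      have "norm (y * q ^ Suc k) \<le> R * norm q ^ Suc k"
        using y by (simp add: norm_mult norm_power mult_right_mono del: power_Suc)
      hence "norm (1 - y * q ^ Suc k) \<ge> 1 / 2"
        using elim norm_triangle_ineq2[of 1 "y * q ^ Suc k"] by simp
      hence "norm (p ^ Suc k * (y * q ^ Suc k)) / norm (1 - y * q ^ Suc k)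
             \<le> norm (p ^ Suc k * (y * q ^ Suc k)) / (1 / 2)"
        by (intro divide_left_mono) (auto intro!: mult_pos_pos)
      also have "\<dots> = 2 * norm y * norm (p * q) ^ Suc k"
        by (simp only: norm_mult norm_power power_mult_distrib) simp
      also have "\<dots> \<le> 2 * R * norm (p * q) ^ Suc k"
        using y by (intro mult_right_mono) auto
      finally show "norm (p ^ Suc k * (y * q ^ Suc k) / (1 - y * q ^ Suc k)) \<le> 2 * R * norm (p * q) ^ Suc k"
        by (simp only: norm_divide)
    qed
  qed
qed

lemma lambert_majorant_summable:
  fixes q p :: complex
  assumes "norm (p * q) < 1"
  shows "summable (\<lambda>k. C * norm (p * q) ^ Suc k)"
  unfolding power_Suc using assms by (intro summable_mult summable_geometric) simp

lemma lambert_summable: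
  fixes q p y :: complex
  assumes "norm q < 1" "norm (p * q) < 1"
  shows "summable (\<lambda>k. p ^ Suc k * (y * q ^ Suc k) / (1 - y * q ^ Suc k))"
proof (rule summable_comparison_test_ev)
  show "summable (\<lambda>k. 2 * norm y * norm (p * q) ^ Suc k)"
    using assms(2) by (rule lambert_majorant_summable)
  show "\<forall>\<^sub>F k in sequentially. norm (p ^ Suc k * (y * q ^ Suc k) / (1 - y * q ^ Suc k)) \<le>
          2 * norm y * norm (p * q) ^ Suc k"
    using lambert_term_bound[OF assms(1), of "norm y" p] by eventually_elim auto
qed

lemma lambert_analytic:
  assumes q: "norm q < 1" "norm (p * q) < 1"
  shows "lambert q p analytic_on {y. \<forall>n. y * q ^ Suc n \<noteq> 1}"
  unfolding analytic_on_def
proof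
  fix y0 :: complex assume y0: "y0 \<in> {y. \<forall>n. y * q ^ Suc n \<noteq> 1}"
  define R where "R = norm y0 + 1"
  have "(\<lambda>k. R * norm q ^ k) \<longlonglongrightarrow> R * 0"
    using q by (intro tendsto_intros LIMSEQ_Suc LIMSEQ_power_zero) auto
  hence "\<forall>\<^sub>F k in sequentially. R * norm q ^ k < 1"
    by (rule order_tendstoD) auto
  then obtain K where K: "\<And>k. k \<ge> K \<Longrightarrow> R * norm q ^ k < 1"
    by (auto simp: eventually_sequentially)
  \<comment> \<open>From index \<open>K\<close> on no pole meets the disc of radius
    \<open>R\<close>, so only finitely many poles have to be cut out and \<open>S\<close> is
    open.\<close>
  define S where "S = ball 0 R \<inter> (\<Inter>n\<in>{..<K}. {y. y * q ^ Suc n \<noteq> 1})"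
  have "open S"
    unfolding S_def by (intro open_Int open_INT ballI open_Collect_neq) (auto intro!: continuous_intros)
  have S: "y * q ^ Suc n \<noteq> 1" "norm y \<le> R" if "y \<in> S" for y n
  proof -
    show "y * q ^ Suc n \<noteq> 1"
    proof (cases "n < K")
      case False
      have "norm (y * q ^ Suc n) \<le> R * norm q ^ Suc n"
        using that by (simp add: norm_mult norm_power mult_right_mono S_def del: power_Suc)
      also have "\<dots> < 1"
        using False by (intro K) auto
      finally show ?thesis by auto
    qed (use that in \<open>auto simp: S_def\<close>)
    show "norm y \<le> R"
      using that by (simp add: S_def)
  qed
  have "lambert q p holomorphic_on S"
  proof (rule holomorphic_uniform_sequence[OF \<open>open S\<close>])
    show "(\<lambda>y. \<Sum>k<n. p ^ Suc k * (y * q ^ Suc k) / (1 - y * q ^ Suc k)) holomorphic_on S" for n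
      using S(1) by (intro holomorphic_intros) (metis eq_iff_diff_eq_0)
    fix x assume "x \<in> S"
    then obtain d where d: "d > 0" "cball x d \<subseteq> S"
      using \<open>open S\<close> open_contains_cball by blast
    have "uniform_limit (cball x d) (\<lambda>n y. \<Sum>k<n. p ^ Suc k * (y * q ^ Suc k) / (1 - y * q ^ Suc k))
            (lambert q p) sequentially"
      unfolding lambert_def
    proof (rule Weierstrass_m_test_ev)
      show "summable (\<lambda>k. 2 * R * norm (p * q) ^ Suc k)"
        using q(2) by (rule lambert_majorant_summable)
      show "\<forall>\<^sub>F k in sequentially. \<forall>y\<in>cball x d. norm (p ^ Suc k * (y * q ^ Suc k) / (1 - y * q ^ Suc k)) \<le>
              2 * R * norm (p * q) ^ Suc k"
        using lambert_term_bound[OF q(1), of R p] by eventually_elim (use d S(2) in auto)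
    qed
    thus "\<exists>d>0. cball x d \<subseteq> S \<and> uniform_limit (cball x d)
            (\<lambda>n y. \<Sum>k<n. p ^ Suc k * (y * q ^ Suc k) / (1 - y * q ^ Suc k)) (lambert q p) sequentially"
      using d by blast
  qed
  moreover have "y0 \<in> S"
    using y0 by (simp add: S_def R_def)
  ultimately show "\<exists>e>0. lambert q p holomorphic_on ball y0 e"
    using \<open>open S\<close> by (meson holomorphic_on_subset open_contains_ball)
qed

lemma lambert_shift:
  assumes q: "norm q < 1" "norm (p * q) < 1" and "p \<noteq> 0"
  shows "lambert q p (y * q) = inverse p * (lambert q p y - p * (y * q) / (1 - y * q))"
proof -
  define t where "t = (\<lambda>k. p ^ Suc k * (y * q ^ Suc k) / (1 - y * q ^ Suc k))"
  have "lambert q p (y * q) = (\<Sum>k. inverse p * t (Suc k))"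
    unfolding lambert_def t_def using \<open>p \<noteq> 0\<close> by (intro suminf_cong) (simp add: mult_ac)
  also have "\<dots> = inverse p * (\<Sum>k. t (Suc k))"
    using lambert_summable[OF q, of y, folded t_def]
    by (intro suminf_mult) (simp only: summable_Suc_iff)
  also have "(\<Sum>k. t (Suc k)) = lambert q p y - t 0"
    using suminf_split_head[OF lambert_summable[OF q, of y, folded t_def]] by (simp add: t_def lambert_def)
  finally show ?thesis
    by (simp add: t_def)
qed

text \<open>For \<open>norm q < norm p < 1 / norm q\<close> the only poles in nonzero
  \<open>y\<close> are at powers of \<open>q\<close>. The rational terms carry the poles at
  \<open>y = 1\<close> and \<open>p = 1\<close>.\<close>

definition kronecker :: "complex \<Rightarrow> complex \<Rightarrow> complex \<Rightarrow> complex" where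
  "kronecker q p y = 1 / (y - 1) + p / (p - 1) - lambert q p y + lambert q (inverse p) (inverse y)"

text \<open>Each Lambert series reproduces itself up to the multiplier and one boundary term. The
  boundary term of the first turns \<open>1 / (y * q - 1)\<close> into \<open>-1\<close>, which
  changes \<open>p / (p - 1)\<close> into its multiple by \<open>inverse p\<close>; that of the
  second supplies the new \<open>1 / (y - 1)\<close>.\<close>

lemma kronecker_shift:
  assumes q: "norm q < 1" "norm (p * q) < 1" "norm (inverse p * q) < 1"
    and "p \<noteq> 0" "q \<noteq> 0" "y \<noteq> 0" "p \<noteq> 1" "y \<noteq> 1" "y * q \<noteq> 1"
  shows "kronecker q p (y * q) = inverse p * kronecker q p y"
proof -
  have *: "lambert q p (y * q) = inverse p * (lambert q p y - p * (y * q) / (1 - y * q))"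
    using assms by (intro lambert_shift) auto
  have "lambert q (inverse p) (inverse (y * q) * q) = inverse (inverse p) *
          (lambert q (inverse p) (inverse (y * q)) -
           inverse p * (inverse (y * q) * q) / (1 - inverse (y * q) * q))"
    using assms by (intro lambert_shift) auto
  also have "inverse (y * q) * q = inverse y"
    using assms by (simp add: field_simps)
  finally have **: "lambert q (inverse p) (inverse (y * q)) =
      inverse p * lambert q (inverse p) (inverse y) + inverse p * inverse y / (1 - inverse y)"
    using assms by (simp add: field_simps)
  have nz: "p - 1 \<noteq> 0" "y - 1 \<noteq> 0" "y * q - 1 \<noteq> 0" "1 - y * q \<noteq> 0"
    using assms by auto
  have "inverse y / (1 - inverse y) = 1 / (y - 1)"
    using assms by (simp add: field_simps)
  moreover have "1 / (y * q - 1) + (y * q) / (1 - y * q) = - 1"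
    using nz by (simp add: divide_simps) (simp add: algebra_simps)
  moreover have "p / (p - 1) - 1 = inverse p * (p / (p - 1))"
    using nz assms by (simp add: field_simps)
  moreover have "kronecker q p (y * q) = (1 / (y * q - 1) + (y * q) / (1 - y * q)) + p / (p - 1)
      - inverse p * lambert q p y + inverse p * lambert q (inverse p) (inverse y)
      + inverse p * (inverse y / (1 - inverse y))"
    unfolding kronecker_def * ** using assms(4) by (simp add: ring_distribs)
  ultimately show ?thesis
    by (simp add: kronecker_def ring_distribs)
qed

section \<open>Kronecker's identity\<close>

lemma norm_nome_strip:
  assumes "\<bar>Im z\<bar> < Im \<tau>"
  shows "norm (nome z * nome \<tau>) < 1" "norm (inverse (nome z) * nome \<tau>) < 1"
proof -
  show "norm (nome z * nome \<tau>) < 1"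
    using norm_nome_less_1[of "z + \<tau>"] assms by (simp add: nome_add)
  show "norm (inverse (nome z) * nome \<tau>) < 1"
    using norm_nome_less_1[of "- z + \<tau>"] assms by (simp only: nome_add nome_minus) simp
qed

text \<open>Zeros lie at points \<open>j + k * \<tau>\<close> with integers \<open>j\<close> and
  \<open>k\<close>; in the strip the imaginary part leaves only \<open>k = 0\<close>, that is, an
  integer.\<close>

lemma theta1_nonzero_strip:
  assumes "\<bar>Im z\<bar> < Im \<tau>" "z \<notin> \<int>"
  shows "theta1 z \<tau> \<noteq> 0"
proof (rule theta1_nonzero)
  show tau: "Im \<tau> > 0"
    using assms(1) by linarith
  fix m n :: nat
  show "nome z * nome \<tau> ^ m \<noteq> nome \<tau> ^ n"
  proof
    assume eq: "nome z * nome \<tau> ^ m = nome \<tau> ^ n"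
    hence "nome (z + of_nat m * \<tau> - of_nat n * \<tau>) = 1"
      by (simp add: nome_add nome_diff nome_of_nat_mult)
    then obtain k where k: "z + of_nat m * \<tau> - of_nat n * \<tau> = of_int k"
      by (auto simp: nome_eq_1_iff elim: Ints_cases)
    have "Im z = (real n - real m) * Im \<tau>"
      using arg_cong[OF k, of Im] by (simp add: algebra_simps)
    hence "\<bar>real n - real m\<bar> * Im \<tau> < 1 * Im \<tau>"
      using assms(1) tau by (simp add: abs_mult)
    hence "\<bar>real n - real m\<bar> < 1"
      using tau mult_less_cancel_right_pos by blast
    hence "n = m"
      by linarith
    thus False
      using k assms(2) by simp
  qed
qed

lemma eventually_theta1_nonzero:
  assumes "Im \<tau> > 0"
  shows "\<forall>\<^sub>F x in at w. theta1 x \<tau> \<noteq> 0"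
proof -
  have "(\<lambda>z. theta1 z \<tau>) \<noteq> (\<lambda>_. 0)"
    using deriv_theta1_0_nonzero[OF assms] by auto
  then obtain b where "theta1 b \<tau> \<noteq> 0"
    by auto
  hence "\<forall>\<^sub>F x in at w. theta1 x \<tau> \<noteq> 0 \<and> x \<in> UNIV"
    by (intro non_zero_neighbour_alt[OF theta1_holomorphic[OF assms]]) auto
  thus ?thesis
    by simp
qed

lemma theta1_zeroE:
  assumes "Im \<tau> > 0" "theta1 z \<tau> = 0"
  obtains j k :: int where "z = of_int j + of_int k * \<tau>"
proof -
  obtain m n where eq: "nome z * nome \<tau> ^ m = nome \<tau> ^ n"
    using theta1_nonzero assms by blast
  hence "nome (z + of_nat m * \<tau> - of_nat n * \<tau>) = 1"
    by (simp add: nome_add nome_diff nome_of_nat_mult)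
  then obtain j where "z + of_nat m * \<tau> - of_nat n * \<tau> = of_int j"
    by (auto simp: nome_eq_1_iff elim: Ints_cases)
  hence "z = of_int j + of_int (int n - int m) * \<tau>"
    by (simp add: algebra_simps add_eq_0_iff)
  thus ?thesis
    by (rule that)
qed

lemma theta1_analytic:
  assumes "Im \<tau> > 0" "f analytic_on S"
  shows "(\<lambda>x. theta1 (f x) \<tau>) analytic_on S"
  using analytic_on_compose_gen[OF assms(2), of "\<lambda>z. theta1 z \<tau>" UNIV] theta1_holomorphic[OF assms(1)]
  by (simp add: o_def analytic_on_open)

lemma nome_analytic [analytic_intros]:
  "f analytic_on S \<Longrightarrow> (\<lambda>x. nome (f x)) analytic_on S"
  unfolding nome_def by (intro analytic_intros)

lemma lambert_difference_analytic:
  assumes q: "norm q < 1" "norm (p * q) < 1" "norm (inverse p * q) < 1"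
    and x: "\<And>n. nome x * q ^ Suc n \<noteq> 1" "\<And>n. inverse (nome x) * q ^ Suc n \<noteq> 1"
  shows "(\<lambda>x. p / (p - 1) - lambert q p (nome x) + lambert q (inverse p) (inverse (nome x))) analytic_on {x}"
proof -
  have "(\<lambda>x. lambert q p (nome x)) analytic_on {x}"
    using analytic_on_compose_gen[OF _ lambert_analytic[OF q(1,2)], of nome "{x}"] x(1)
    by (simp add: o_def analytic_intros)
  moreover have "(\<lambda>x. lambert q (inverse p) (inverse (nome x))) analytic_on {x}"
    using analytic_on_compose_gen[OF _ lambert_analytic[OF q(1,3)], of "\<lambda>x. inverse (nome x)" "{x}"] x(2)
    by (simp add: o_def analytic_intros)
  ultimately show ?thesis
    by (intro analytic_intros)
qed

lemma theta1_quotient_tendsto: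
  assumes "Im \<tau> > 0"
  shows "((\<lambda>x. x / theta1 x \<tau>) \<longlongrightarrow> 1 / deriv (\<lambda>w. theta1 w \<tau>) 0) (at 0)"
proof -
  have "((\<lambda>w. theta1 w \<tau>) has_field_derivative deriv (\<lambda>w. theta1 w \<tau>) 0) (at 0)"
    using theta1_holomorphic[OF assms] by (intro holomorphic_derivI[of _ UNIV]) auto
  hence "((\<lambda>x. theta1 x \<tau> / x) \<longlongrightarrow> deriv (\<lambda>w. theta1 w \<tau>) 0) (at 0)"
    by (simp add: DERIV_def)
  from tendsto_inverse[OF this] show ?thesis
    using deriv_theta1_0_nonzero[OF assms] by (simp add: inverse_eq_divide)
qed

lemma nome_quotient_tendsto:
  "((\<lambda>x. x / (nome x - 1)) \<longlongrightarrow> 1 / (2 * of_real pi * \<i>)) (at 0)"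
proof -
  have "(nome has_field_derivative 2 * of_real pi * \<i>) (at 0)"
    unfolding nome_def by (auto intro!: derivative_eq_intros)
  hence "((\<lambda>x. (nome x - 1) / x) \<longlongrightarrow> 2 * of_real pi * \<i>) (at 0)"
    by (simp add: DERIV_def)
  from tendsto_inverse[OF this] show ?thesis
    by (simp add: inverse_eq_divide)
qed

text \<open>A limit of \<open>f\<close> exists exactly if one of \<open>c * f\<close> does; where
  there is none, \<open>remove_sings\<close> has the default value 0 on both sides.\<close>

lemma remove_sings_cmult:
  fixes c :: complex
  assumes "c \<noteq> 0"
  shows "remove_sings (\<lambda>x. c * f x) w = c * remove_sings f w"
proof (cases "\<exists>l. f \<midarrow>w\<rightarrow> l")
  case True
  then obtain l where l: "f \<midarrow>w\<rightarrow> l"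
    by blast
  hence "(\<lambda>x. c * f x) \<midarrow>w\<rightarrow> c * l"
    by (intro tendsto_intros)
  thus ?thesis
    using l remove_sings_eqI by metis
next
  case False
  have "\<not> (\<lambda>x. c * f x) \<midarrow>w\<rightarrow> l" for l
  proof
    assume "(\<lambda>x. c * f x) \<midarrow>w\<rightarrow> l"
    hence "(\<lambda>x. inverse c * (c * f x)) \<midarrow>w\<rightarrow> inverse c * l"
      by (intro tendsto_intros)
    thus False
      using False assms by (simp add: mult.assoc [symmetric])
  qed
  thus ?thesis
    using False by (simp add: remove_sings_def)
qed

text \<open>
  The difference of the two sides, divided by \<open>theta1 x \<tau> * theta1 z \<tau>\<close>, has removable
  singularities only, because the residues at \<open>x = 0\<close> agree, and it has the multipliers
  \<open>1\<close> and \<open>p\<^sup>-\<^sup>1\<close> under \<open>x \<mapsto> x + 1\<close> and \<open>x \<mapsto> x + \<tau>\<close>.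
\<close>

theorem kronecker_theta1:
  assumes z: "\<bar>Im z\<bar> < Im \<tau>" "z \<notin> \<int>" and x: "theta1 x \<tau> \<noteq> 0"
  shows "kronecker (nome \<tau>) (nome z) (nome x) * theta1 x \<tau> * theta1 z \<tau>
         = theta1_bullet 0 \<tau> * theta1 (z + x) \<tau>"
proof -
  have tau: "Im \<tau> > 0"
    using z by linarith
  define p q b where "p = nome z" and "q = nome \<tau>" and "b = theta1_bullet 0 \<tau>"
  have q: "norm q < 1" "norm (p * q) < 1" "norm (inverse p * q) < 1"
    using norm_nome_less_1[OF tau] norm_nome_strip[OF z(1)] by (simp_all add: p_def q_def)
  have nz: "p \<noteq> 0" "q \<noteq> 0" "p \<noteq> 1" "theta1 z \<tau> \<noteq> 0"
    using z(2) theta1_nonzero_strip[OF z] by (simp_all add: p_def q_def nome_eq_1_iff)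
  have off: "nome x * q ^ m \<noteq> q ^ n" if "theta1 x \<tau> \<noteq> 0" for x m n
    using theta1_nonzeroD[OF tau that] by (simp add: q_def)
  define g where "g = (\<lambda>x. p / (p - 1) - lambert q p (nome x) + lambert q (inverse p) (inverse (nome x)))"
  define D where "D = (\<lambda>x. kronecker q p (nome x) - b * theta1 (z + x) \<tau> / (theta1 x \<tau> * theta1 z \<tau>))"
  have D_eq: "D x = 1 / (nome x - 1) + g x - b * theta1 (z + x) \<tau> / (theta1 x \<tau> * theta1 z \<tau>)" for x
    by (simp add: D_def kronecker_def g_def)

  have D_analytic: "D analytic_on {x}" if x: "theta1 x \<tau> \<noteq> 0" for x
  proof -
    have "g analytic_on {x}"
      unfolding g_def
    proof (rule lambert_difference_analytic[OF q])
      show "nome x * q ^ Suc n \<noteq> 1" for n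
        using off[OF x, of "Suc n" 0] by simp
      show "inverse (nome x) * q ^ Suc n \<noteq> 1" for n
        using off[OF x, of 0 "Suc n"] by (auto simp: field_simps)
    qed
    moreover have "nome x \<noteq> 1"
      using off[OF x, of 0 0] by simp
    ultimately show ?thesis
      unfolding D_eq using x nz tau by (intro analytic_intros theta1_analytic) auto
  qed
  have ev: "\<forall>\<^sub>F x in at w. theta1 x \<tau> \<noteq> 0" for w
    by (rule eventually_theta1_nonzero[OF tau])
  have D_isolated: "isolated_singularity_at D w" for w
  proof -
    obtain r where r: "r > 0" "\<And>x. x \<noteq> w \<Longrightarrow> dist x w < r \<Longrightarrow> theta1 x \<tau> \<noteq> 0"
      using ev[of w] by (auto simp: eventually_at)
    hence "D analytic_on ball w r - {w}"
      by (subst analytic_on_analytic_at) (auto intro!: D_analytic simp: dist_commute)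
    thus ?thesis
      using r(1) by (auto simp: isolated_singularity_at_def)
  qed

  \<comment> \<open>The residue \<open>1 / (2 * pi * i)\<close> of \<open>1 / (nome x - 1)\<close>
    is cancelled by that of the theta quotient, because \<open>b\<close> is the derivative of
    \<open>theta1\<close> at 0 divided by \<open>2 * pi * i\<close>.\<close>
  have "((\<lambda>x. x * D x) \<longlongrightarrow> 0) (at 0)"
  proof -
    have "g analytic_on {0}"
      unfolding g_def by (rule lambert_difference_analytic[OF q])
        (use nome_power_ne_1[OF tau] in \<open>auto simp: q_def simp del: power_Suc\<close>)
    hence "(g \<longlongrightarrow> g 0) (at 0)"
      by (intro isContD analytic_at_imp_isCont)
    moreover have "((\<lambda>x. theta1 (z + x) \<tau>) \<longlongrightarrow> theta1 (z + 0) \<tau>) (at 0)"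
      by (intro isContD analytic_at_imp_isCont theta1_analytic[OF tau] analytic_intros)
    ultimately have "((\<lambda>x. x / (nome x - 1) + x * g x - b * theta1 (z + x) \<tau> / theta1 z \<tau> * (x / theta1 x \<tau>))
        \<longlongrightarrow> 1 / (2 * of_real pi * \<i>) + 0 * g 0 -
            b * theta1 (z + 0) \<tau> / theta1 z \<tau> * (1 / deriv (\<lambda>w. theta1 w \<tau>) 0)) (at 0)"
      using nz by (intro tendsto_intros nome_quotient_tendsto theta1_quotient_tendsto[OF tau])
    also have "1 / (2 * of_real pi * \<i>) + 0 * g 0 -
            b * theta1 (z + 0) \<tau> / theta1 z \<tau> * (1 / deriv (\<lambda>w. theta1 w \<tau>) 0) = 0"
      using nz deriv_theta1_0_nonzero[OF tau] by (simp add: b_def theta1_bullet_def dz_def)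
    also have "(\<lambda>x. x / (nome x - 1) + x * g x - b * theta1 (z + x) \<tau> / theta1 z \<tau> * (x / theta1 x \<tau>))
               = (\<lambda>x. x * D x)"
      by (simp add: D_eq fun_eq_iff algebra_simps)
    finally show ?thesis .
  qed
  moreover obtain r where r: "r > 0" "D analytic_on ball 0 r - {0}"
    using D_isolated[of 0] by (auto simp: isolated_singularity_at_def)
  ultimately obtain h where h: "h holomorphic_on ball 0 r" "\<And>x. x \<in> ball 0 r - {0} \<Longrightarrow> h x = D x"
    using holomorphic_on_extend_lim[of D "ball 0 r" 0] by (auto simp: analytic_imp_holomorphic)
  have "(h \<longlongrightarrow> h 0) (at 0)"
    using h(1) r(1) by (intro isContD analytic_at_imp_isCont) (auto simp: analytic_at intro!: exI[of _ "ball 0 r"])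
  moreover have "\<forall>\<^sub>F x in at 0. h x = D x"
    using eventually_at_ball'[OF r(1), of 0 UNIV] by eventually_elim (use h in auto)
  ultimately have "(D \<longlongrightarrow> h 0) (at 0)"
    using tendsto_cong by fast
  hence E_analytic_0: "remove_sings D analytic_on {0}"
    by (rule remove_sings_analytic_at[OF D_isolated])

  define E where "E = remove_sings D"
  have D1: "D (x + 1) = D x" for x
    using theta1_add_1[of "z + x"] by (simp add: D_def nome_add theta1_add_1 add.assoc)
  have Dtau: "D (x + \<tau>) = inverse p * D x" if "theta1 x \<tau> \<noteq> 0" for x
  proof -
    have "kronecker q p (nome x * q) = inverse p * kronecker q p (nome x)"
      using off[OF that, of 0 0] off[OF that, of 1 0] nz by (intro kronecker_shift q) auto
    moreover have "theta1 (z + (x + \<tau>)) \<tau> / (theta1 (x + \<tau>) \<tau> * theta1 z \<tau>) =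
        inverse p * (theta1 (z + x) \<tau> / (theta1 x \<tau> * theta1 z \<tau>))"
      unfolding add.assoc [symmetric] theta1_add_tau[OF tau] by (simp add: nome_add p_def field_simps)
    ultimately show ?thesis
      unfolding D_def nome_add q_def [symmetric] times_divide_eq_right [symmetric] by (simp add: algebra_simps)
  qed
  have shift: "filtermap (\<lambda>x. x + c) (at w) = at (w + c)" for c w :: complex
    using filtermap_at_shift[of "- c" w] by simp
  have E1: "E (w + 1) = E w" for w
    using remove_sings_compose[OF shift, of D 1 w] by (simp add: E_def o_def D1)
  \<comment> \<open>At zeros of \<open>theta1\<close> the values of \<open>D\<close> come from
    division by zero, so the multiplier is known only off them; \<open>remove_sings\<close> depends
    on punctured neighbourhoods alone and carries it to every \<open>w\<close>.\<close>
  have Etau: "E (w + \<tau>) = inverse p * E w" for w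
  proof -
    have "E (w + \<tau>) = remove_sings (\<lambda>x. D (x + \<tau>)) w"
      using remove_sings_compose[OF shift, of D \<tau> w] by (simp add: E_def o_def)
    also have "\<dots> = remove_sings (\<lambda>x. inverse p * D x) w"
      by (rule remove_sings_cong) (use ev[of w] Dtau in \<open>auto elim: eventually_mono\<close>)
    also have "\<dots> = inverse p * E w"
      unfolding E_def using nz by (intro remove_sings_cmult) simp
    finally show ?thesis .
  qed
  have E_int: "E (w + of_int j) = E w" for w j
  proof (induction j rule: int_induct[where k = 0])
    case (step1 i)
    thus ?case using E1[of "w + of_int i"] by (simp add: add.assoc)
  next
    case (step2 i)
    thus ?case using E1[of "w + of_int (i - 1)"] by (simp add: add.assoc)
  qed simp
  \<comment> \<open>An unspecified constant suffices, as this law only serves to transport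
    analyticity from 0 to the other lattice points.\<close>
  have E_int_tau: "\<exists>c. \<forall>w. E (w + of_int k * \<tau>) = c * E w" for k
  proof (induction k rule: int_induct[where k = 0])
    case base
    show ?case by (rule exI[of _ 1]) simp
  next
    case (step1 i)
    then obtain c where c: "\<And>w. E (w + of_int i * \<tau>) = c * E w"
      by auto
    show ?case
      using Etau[of "w + of_int i * \<tau>" for w] c
      by (intro exI[of _ "inverse p * c"]) (simp add: algebra_simps)
  next
    case (step2 i)
    then obtain c where c: "\<And>w. E (w + of_int i * \<tau>) = c * E w"
      by auto
    show ?case
    proof (intro exI allI)
      fix w
      have "w + of_int i * \<tau> = w + of_int (i - 1) * \<tau> + \<tau>"
        by (simp add: algebra_simps)
      hence "inverse p * E (w + of_int (i - 1) * \<tau>) = c * E w"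
        by (metis c Etau)
      thus "E (w + of_int (i - 1) * \<tau>) = p * c * E w"
        using nz by (simp add: field_simps)
    qed
  qed
  have "E analytic_on {w}" for w
  proof (cases "theta1 w \<tau> = 0")
    case False
    thus ?thesis
      unfolding E_def by (intro remove_sings_analytic_on D_analytic)
  next
    case True
    then obtain j k where w: "w = of_int j + of_int k * \<tau>"
      using theta1_zeroE[OF tau] by blast
    obtain c where c: "\<And>w. E (w + of_int k * \<tau>) = c * E w"
      using E_int_tau[of k] by auto
    have eq: "E x = c * E (x - w)" for x
      using E_int[of "x - of_int j" j] c[of "x - of_int k * \<tau> - of_int j"]
        E_int[of "x - of_int k * \<tau> - of_int j" j]
      by (simp add: w algebra_simps)
    have "(\<lambda>x. E (x - w)) analytic_on {w}"
      using analytic_on_compose_gen[of "\<lambda>x. x - w" "{w}" E "{0}"] E_analytic_0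
      by (simp add: o_def E_def analytic_intros)
    hence "(\<lambda>x. c * E (x - w)) analytic_on {w}"
      by (intro analytic_intros)
    thus ?thesis
      by (subst (asm) eq [symmetric])
  qed
  hence "E analytic_on UNIV"
    using analytic_on_analytic_at by blast
  hence "E holomorphic_on UNIV"
    by (simp add: analytic_on_open)
  \<comment> \<open>Equality would make \<open>z + n * \<tau>\<close> an integer; the strip then
    forces \<open>n = 0\<close>, but \<open>z\<close> is not an integer.\<close>
  moreover have "inverse p \<noteq> nome (of_int n * \<tau>)" for n
  proof
    assume "inverse p = nome (of_int n * \<tau>)"
    hence "nome (z + of_int n * \<tau>) = 1"
      using nz by (simp add: nome_add p_def field_simps)
    then obtain j where j: "z + of_int n * \<tau> = of_int j"
      by (auto simp: nome_eq_1_iff elim: Ints_cases)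
    have "Im z = - of_int n * Im \<tau>"
      using arg_cong[OF j, of Im] by (simp add: algebra_simps)
    hence "\<bar>of_int n :: real\<bar> * Im \<tau> < 1 * Im \<tau>"
      using z(1) tau by (simp add: abs_mult)
    hence "\<bar>of_int n :: real\<bar> < 1"
      using tau mult_less_cancel_right_pos by blast
    hence "n = 0"
      by linarith
    thus False
      using j z(2) by simp
  qed
  ultimately have "E x = 0"
    using quasi_periodic_entire_eq_0[OF _ tau E1 Etau] nz by simp
  hence "D x = 0"
    using D_analytic[OF x] by (simp add: E_def)
  thus ?thesis
    using x nz by (simp add: D_def p_def q_def b_def field_simps)
qed

section \<open>Taylor expansion of Kronecker's function\<close>

abbreviation pos_pairs :: "(nat \<times> nat) set" where
  "pos_pairs \<equiv> {1..} \<times> {1..}"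

text \<open>For \<open>k, r \<ge> 1\<close>, \<open>(k - 1) * (r - 1) \<ge> 0\<close> gives
  \<open>k + r \<le> k * r + 1\<close>. So \<open>s ^ (k * r)\<close> is at most
  \<open>inverse s * s ^ k * s ^ r\<close>, and a product of two geometric series dominates the
  double sum.\<close>

lemma summable_on_power_pairs:
  fixes a b s :: real
  assumes "a \<ge> 0" "b \<ge> 0" "s > 0" "s < 1" "a * s < 1" "b * s < 1"
  shows "(\<lambda>(k, r). a ^ k * b ^ r * s ^ (k * r)) summable_on pos_pairs"
proof -
  have "(\<lambda>(k, r). (a * s) ^ k * (b * s) ^ r) summable_on pos_pairs"
  proof (rule summable_on_SigmaI)
    show "((\<lambda>r. (\<lambda>(k, r). (a * s) ^ k * (b * s) ^ r) (k, r)) has_sum (a * s) ^ k * (b * s / (1 - b * s))) {1..}" for k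
      unfolding prod.case using assms by (intro has_sum_cmult_right has_sum_geometric_from_1) auto
    show "(\<lambda>k. (a * s) ^ k * (b * s / (1 - b * s))) summable_on {1..}"
      using assms has_sum_geometric_from_1[of "a * s"]
      by (intro summable_on_cmult_left) (auto dest: has_sum_imp_summable)
  qed (use assms in auto)
  hence "(\<lambda>kr. inverse s * (case kr of (k, r) \<Rightarrow> (a * s) ^ k * (b * s) ^ r)) summable_on pos_pairs"
    by (rule summable_on_cmult_right)
  thus ?thesis
  proof (rule summable_on_comparison_test)
    fix kr assume "kr \<in> pos_pairs"
    then obtain k r where kr: "kr = (k, r)" "k \<ge> 1" "r \<ge> 1"
      by auto
    obtain k' r' where "k = Suc k'" "r = Suc r'"
      using kr by (metis Suc_le_D One_nat_def)
    hence "k + r \<le> Suc (k * r)"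
      by simp
    hence "s ^ Suc (k * r) \<le> s ^ (k + r)"
      using assms by (intro power_decreasing) auto
    hence "s ^ (k * r) \<le> inverse s * s ^ (k + r)"
      using assms by (simp add: field_simps)
    hence "a ^ k * b ^ r * s ^ (k * r) \<le> a ^ k * b ^ r * (inverse s * s ^ (k + r))"
      using assms by (intro mult_left_mono) auto
    thus "(case kr of (k, r) \<Rightarrow> a ^ k * b ^ r * s ^ (k * r))
          \<le> inverse s * (case kr of (k, r) \<Rightarrow> (a * s) ^ k * (b * s) ^ r)"
      by (simp add: kr power_mult_distrib power_add mult_ac)
  qed (use assms in auto)
qed

text \<open>One absolutely summable family over \<open>k, r, m\<close> is summed in two orders.
  Summing over \<open>m\<close>, then \<open>r\<close>, then \<open>k\<close> gives exponentials,
  geometric series and finally the Lambert series; summing over the pairs first gives the Taylor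
  coefficients in \<open>x\<close>.\<close>

lemma lambert_taylor:
  fixes q P x :: complex
  assumes q: "q \<noteq> 0" "norm q < 1" "norm (P * q) < 1" and x: "exp (norm x) * norm q < 1" "x \<noteq> 0"
  shows "(\<lambda>(k, r). of_nat r ^ m * P ^ k * q ^ (k * r)) summable_on pos_pairs" (is "?summable m")
    and "(\<lambda>m. x ^ m / fact m * (\<Sum>\<^sub>\<infinity>(k, r)\<in>pos_pairs. of_nat r ^ m * P ^ k * q ^ (k * r)))
           sums lambert q P (exp x)"
proof -
  define f where "f = (\<lambda>(kr, m). case kr of (k, r) \<Rightarrow>
                       P ^ k * q ^ (k * r) * ((of_nat r * x) ^ m / fact m))"
  have "(\<lambda>z. norm (f z)) summable_on pos_pairs \<times> UNIV"
  proof (rule summable_on_SigmaI)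
    show "((\<lambda>m. norm (f (kr, m))) has_sum
            (case kr of (k, r) \<Rightarrow> norm P ^ k * exp (norm x) ^ r * norm q ^ (k * r))) UNIV" for kr
    proof -
      obtain k r where kr: "kr = (k, r)"
        by (cases kr)
      have "(\<lambda>m. (real r * norm x) ^ m / fact m) sums exp (real r * norm x)"
        using exp_converges[of "real r * norm x"] by (simp add: field_simps)
      hence "((\<lambda>m. (real r * norm x) ^ m / fact m) has_sum exp (real r * norm x)) UNIV"
        by (intro norm_summable_imp_has_sum) (auto simp: sums_iff)
      hence "((\<lambda>m. norm P ^ k * norm q ^ (k * r) * ((real r * norm x) ^ m / fact m)) has_sum
              norm P ^ k * norm q ^ (k * r) * exp (real r * norm x)) UNIV"
        by (rule has_sum_cmult_right)
      thus ?thesis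
        by (simp add: kr f_def norm_mult norm_divide norm_power exp_of_nat_mult mult_ac)
    qed
    show "(\<lambda>(k, r). norm P ^ k * exp (norm x) ^ r * norm q ^ (k * r)) summable_on pos_pairs"
      using q x by (intro summable_on_power_pairs) (auto simp: norm_mult)
  qed auto
  hence summ: "f summable_on pos_pairs \<times> UNIV"
    by (rule abs_summable_summable)
  hence summ': "(\<lambda>(m, kr). f (kr, m)) summable_on UNIV \<times> pos_pairs"
    by (simp add: summable_on_swap[of f])
  have inner: "(\<lambda>kr. f (kr, m)) summable_on pos_pairs" for m
    using summable_on_SigmaD1[OF summ'] by simp
  have f_eq: "f (kr, m) = x ^ m / fact m * (case kr of (k, r) \<Rightarrow> of_nat r ^ m * P ^ k * q ^ (k * r))" for kr m
    by (cases kr) (simp add: f_def power_mult_distrib)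
  show "?summable m" for m
    using summable_on_cmult_right[OF inner[of m], of "fact m / x ^ m"] x(2) by (simp add: f_eq)

  define S where "S = infsum f (pos_pairs \<times> UNIV)"
  have S: "(f has_sum S) (pos_pairs \<times> UNIV)"
    using summ by (simp add: S_def)
  have "((\<lambda>(k, r). P ^ k * (exp x) ^ r * q ^ (k * r)) has_sum S) pos_pairs"
  proof (rule has_sum_SigmaD[OF S])
    fix kr :: "nat \<times> nat"
    obtain k r where kr: "kr = (k, r)"
      by (cases kr)
    have "(\<lambda>m. (of_nat r * x) ^ m / fact m) sums exp (of_nat r * x)"
      using exp_converges[of "of_nat r * x"] by (simp add: scaleR_conv_of_real field_simps)
    moreover have "summable (\<lambda>m. norm ((of_nat r * x) ^ m / fact m))"
      using summable_norm_exp[of "of_nat r * x"] by (simp add: norm_mult norm_inverse divide_inverse mult_ac)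
    ultimately have "((\<lambda>m. (of_nat r * x) ^ m / fact m) has_sum exp (of_nat r * x)) UNIV"
      by (intro norm_summable_imp_has_sum)
    from has_sum_cmult_right[OF this, of "P ^ k * q ^ (k * r)"]
    show "((\<lambda>m. f (kr, m)) has_sum (case kr of (k, r) \<Rightarrow> P ^ k * exp x ^ r * q ^ (k * r))) UNIV"
      by (simp add: kr f_def exp_of_nat_mult [symmetric] mult_ac)
  qed
  hence "((\<lambda>k. P ^ k * (exp x * q ^ k / (1 - exp x * q ^ k))) has_sum S) {1..}"
  proof (rule has_sum_SigmaD)
    fix k :: nat assume "k \<in> {1..}"
    then obtain k' where k: "k = Suc k'"
      by (cases k) auto
    have "norm (exp x * q ^ k) \<le> exp (norm x) * norm q ^ k"
      using norm_exp[of x] by (simp add: norm_mult norm_power mult_right_mono)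
    also have "\<dots> \<le> exp (norm x) * norm q"
      using q power_decreasing[of 1 k "norm q"] k by simp
    also have "\<dots> < 1"
      using x by simp
    finally have "((\<lambda>r. (exp x * q ^ k) ^ r) has_sum exp x * q ^ k / (1 - exp x * q ^ k)) {1..}"
      by (rule has_sum_geometric_from_1)
    from has_sum_cmult_right[OF this, of "P ^ k"]
    show "((\<lambda>r. case (k, r) of (k, r) \<Rightarrow> P ^ k * exp x ^ r * q ^ (k * r)) has_sum
             P ^ k * (exp x * q ^ k / (1 - exp x * q ^ k))) {1..}"
      by (simp add: power_mult_distrib power_mult mult_ac)
  qed
  also have "{1..} = range Suc"
    by (auto simp: image_iff) (metis Suc_le_D One_nat_def)
  finally have "((\<lambda>k. P ^ Suc k * (exp x * q ^ Suc k / (1 - exp x * q ^ Suc k))) has_sum S) UNIV"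
    by (subst (asm) has_sum_reindex) (auto simp: o_def)
  hence S_eq: "S = lambert q P (exp x)"
    unfolding lambert_def using has_sum_imp_sums sums_unique by fastforce

  have "((\<lambda>(m, kr). f (kr, m)) has_sum S) (UNIV \<times> pos_pairs)"
    using S has_sum_swap by blast
  hence "((\<lambda>m. \<Sum>\<^sub>\<infinity>kr\<in>pos_pairs. f (kr, m)) has_sum S) UNIV"
    by (rule has_sum_SigmaD) (use inner in auto)
  hence "(\<lambda>m. \<Sum>\<^sub>\<infinity>kr\<in>pos_pairs. f (kr, m)) sums S"
    by (rule has_sum_imp_sums)
  thus "(\<lambda>m. x ^ m / fact m * (\<Sum>\<^sub>\<infinity>(k, r)\<in>pos_pairs. of_nat r ^ m * P ^ k * q ^ (k * r)))
           sums lambert q P (exp x)"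
    unfolding f_eq S_eq infsum_cmult_right' .
qed

text \<open>The neighbourhood has to be punctured: at \<open>x = 0\<close> the quotient is 0 by the
  convention for division, while the series has the value 1.\<close>

lemma bernoulli_number_sums:
  "\<forall>\<^sub>F x in at 0. (\<lambda>n. bernoulli_number n / fact n * x ^ n) sums (x / (exp x - 1))"
proof -
  define F where "F = fps_X / (fps_exp 1 - 1 :: complex fps)"
  have sub: "subdegree (fps_exp 1 - 1 :: complex fps) = 1"
    by (intro subdegreeI) auto
  hence "(fps_exp 1 - 1 :: complex fps) \<noteq> 0"
    by (metis subdegree_0 zero_neq_one)
  hence "(\<lambda>x. if x = 0 then fps_nth fps_X 1 / fps_nth (fps_exp 1 - 1) 1 else x / (exp x - 1)) has_fps_expansion F"
    unfolding F_def using sub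
    by (intro has_fps_expansion_divide has_fps_expansion_diff has_fps_expansion_fps_X
              has_fps_expansion_exp1 has_fps_expansion_1) auto
  hence F: "fps_conv_radius F > 0"
    "\<forall>\<^sub>F x in nhds 0. eval_fps F x = (if x = 0 then fps_nth fps_X 1 / fps_nth (fps_exp 1 - 1) 1 else x / (exp x - 1))"
    by (auto simp: has_fps_expansion_def)
  have "\<forall>\<^sub>F x in nhds 0. x \<in> eball 0 (fps_conv_radius F)"
    using F(1) by (intro eventually_nhds_in_open) (auto simp: zero_ereal_def)
  with F(2) have "\<forall>\<^sub>F x in nhds 0. x \<noteq> 0 \<longrightarrow> (\<lambda>n. fps_nth F n * x ^ n) sums (x / (exp x - 1))"
  proof eventually_elim
    case (elim x)
    show ?case
    proof
      assume "x \<noteq> 0"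
      hence "eval_fps F x = x / (exp x - 1)"
        using elim by simp
      moreover have "(\<lambda>n. fps_nth F n * x ^ n) sums eval_fps F x"
        using elim by (intro sums_eval_fps) auto
      ultimately show "(\<lambda>n. fps_nth F n * x ^ n) sums (x / (exp x - 1))"
        by (simp only:)
    qed
  qed
  moreover have "bernoulli_number n / fact n = fps_nth F n" for n
    by (simp add: bernoulli_number_def F_def)
  ultimately show ?thesis
    by (simp add: eventually_at_filter)
qed

text \<open>With \<open>n = m + 1\<close>, the factor \<open>n * r ^ (n - 1) / n!\<close> is
  \<open>r ^ m / m!\<close>, a Taylor coefficient of \<open>exp (r * x)\<close>; the index shift
  produces the overall \<open>x\<close>. The sign \<open>(-1) ^ n\<close> comes from the second
  Lambert series being taken at \<open>exp (- x)\<close>.\<close>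

lemma J_series_sums:
  assumes z: "\<bar>Im z\<bar> < Im \<tau>"
  shows "\<forall>\<^sub>F x in at 0. (\<lambda>n. J_series n z \<tau> / fact n * x ^ n) sums
           (x * kronecker (nome \<tau>) (nome z) (exp x))"
proof -
  define p q where "p = nome z" and "q = nome \<tau>"
  have tau: "Im \<tau> > 0"
    using z by linarith
  have q: "norm q < 1" "norm (p * q) < 1" "norm (inverse p * q) < 1" "q \<noteq> 0" "p \<noteq> 0"
    using norm_nome_less_1[OF tau] norm_nome_strip[OF z(1)] by (simp_all add: p_def q_def)
  have "((\<lambda>x::complex. exp (norm x) * norm q) \<longlongrightarrow> exp (norm (0::complex)) * norm q) (at 0)"
    by (intro tendsto_intros)
  hence "\<forall>\<^sub>F x::complex in at 0. exp (norm x) * norm q < 1"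
    using q(1) by (intro order_tendstoD) auto
  moreover have "\<forall>\<^sub>F x::complex in at 0. x \<noteq> 0"
    by (rule eventually_neq_at_within)
  ultimately show ?thesis
    using bernoulli_number_sums
  proof eventually_elim
    case (elim x)
    define L where "L = (\<lambda>P m. \<Sum>\<^sub>\<infinity>(k, r)\<in>pos_pairs. of_nat r ^ m * P ^ k * q ^ (k * r))"
    have 1: "(\<lambda>m. x ^ m / fact m * L p m) sums lambert q p (exp x)"
      unfolding L_def using q elim by (intro lambert_taylor) auto
    have 2: "(\<lambda>m. (-x) ^ m / fact m * L (inverse p) m) sums lambert q (inverse p) (exp (-x))"
      unfolding L_def using q elim by (intro lambert_taylor) auto
    define t where "t = (\<lambda>m. x * (x ^ m / fact m * L p m - (-x) ^ m / fact m * L (inverse p) m))"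
    have "t sums (x * (lambert q p (exp x) - lambert q (inverse p) (exp (-x))))"
      unfolding t_def by (intro sums_mult sums_diff 1 2)
    hence 3: "(\<lambda>n. case n of 0 \<Rightarrow> 0 | Suc m \<Rightarrow> t m) sums
                (x * (lambert q p (exp x) - lambert q (inverse p) (exp (-x))) + 0)"
      using sums_Suc[of "\<lambda>n. case n of 0 \<Rightarrow> 0 | Suc m \<Rightarrow> t m"] by simp
    have 4: "(\<lambda>n. if n = 1 then p / (p - 1) * x else 0) sums (p / (p - 1) * x)"
      using sums_single[of 1 "\<lambda>_. p / (p - 1) * x"] by simp
    have summ: "(\<lambda>(k, r). of_nat r ^ m * P ^ k * q ^ (k * r)) summable_on pos_pairs"
      if "P = p \<or> P = inverse p" for m P
      using q elim that by (intro lambert_taylor(1)[where x = x]) auto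
    have "(\<lambda>n. bernoulli_number n / fact n * x ^ n + (if n = 1 then p / (p - 1) * x else 0)
             - (case n of 0 \<Rightarrow> 0 | Suc m \<Rightarrow> t m)) sums
          (x / (exp x - 1) + p / (p - 1) * x
             - (x * (lambert q p (exp x) - lambert q (inverse p) (exp (-x))) + 0))"
      by (intro sums_diff sums_add 3 4 elim)
    also have "x / (exp x - 1) + p / (p - 1) * x
             - (x * (lambert q p (exp x) - lambert q (inverse p) (exp (-x))) + 0)
             = x * kronecker q p (exp x)"
      by (simp add: kronecker_def exp_minus algebra_simps)
    also have "(\<lambda>n. bernoulli_number n / fact n * x ^ n + (if n = 1 then p / (p - 1) * x else 0)
             - (case n of 0 \<Rightarrow> 0 | Suc m \<Rightarrow> t m)) = (\<lambda>n. J_series n z \<tau> / fact n * x ^ n)"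
    proof
      fix n
      show "bernoulli_number n / fact n * x ^ n + (if n = 1 then p / (p - 1) * x else 0)
             - (case n of 0 \<Rightarrow> 0 | Suc m \<Rightarrow> t m) = J_series n z \<tau> / fact n * x ^ n"
      proof (cases n)
        \<comment> \<open>The factor \<open>of_nat n\<close> removes the double sum with its powers
          \<open>r powi (-1)\<close>, so only the Bernoulli term is left.\<close>
        case 0
        thus ?thesis by (simp add: J_series_def)
      next
        case (Suc m)
        have "(\<Sum>\<^sub>\<infinity>(k, r)\<in>pos_pairs. of_nat r powi (int n - 1) *
                 (p ^ k + (-1) ^ n * p powi (- int k)) * q ^ (k * r)) =
              (\<Sum>\<^sub>\<infinity>kr\<in>pos_pairs. (case kr of (k, r) \<Rightarrow> of_nat r ^ m * p ^ k * q ^ (k * r))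
                 + - ((-1) ^ m) * (case kr of (k, r) \<Rightarrow> of_nat r ^ m * inverse p ^ k * q ^ (k * r)))"
          by (intro infsum_cong) (auto simp: Suc power_int_minus field_simps)
        also have "\<dots> = L p m + (\<Sum>\<^sub>\<infinity>kr\<in>pos_pairs. - ((-1) ^ m) *
                     (case kr of (k, r) \<Rightarrow> of_nat r ^ m * inverse p ^ k * q ^ (k * r)))"
          unfolding L_def by (intro infsum_add summ summable_on_cmult_right) auto
        also have "\<dots> = L p m - (-1) ^ m * L (inverse p) m"
          unfolding L_def infsum_cmult_right' by simp
        finally have "J_series n z \<tau> = (if n = 1 then p / (p - 1) else 0) + bernoulli_number n
                        - of_nat n * (L p m - (-1) ^ m * L (inverse p) m)"
          by (simp add: J_series_def p_def q_def)
        moreover have "t m = of_nat n * (L p m - (-1) ^ m * L (inverse p) m) / fact n * x ^ n"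
        proof -
          have "(-x) ^ m = (-1) ^ m * x ^ m"
            by (metis mult_minus1 power_mult_distrib)
          hence "t m = 1 / fact m * (L p m - (-1) ^ m * L (inverse p) m) * x ^ Suc m"
            by (simp add: t_def field_simps)
          also have "1 / (fact m :: complex) = of_nat (Suc m) / fact (Suc m)"
            by (simp add: divide_simps del: of_nat_Suc)
          finally show ?thesis
            by (simp add: Suc del: of_nat_Suc fact_Suc)
        qed
        ultimately show ?thesis
          by (simp add: Suc ring_distribs add_divide_distrib diff_divide_distrib)
      qed
    qed
    finally show ?case
      by (simp add: p_def q_def)
  qed
qed

section \<open>Meromorphic continuation\<close>

lemma dz_power:
  assumes "f holomorphic_on UNIV"
  shows "(dz ^^ k) f = (\<lambda>z. (deriv ^^ k) f z / (2 * of_real pi * \<i>) ^ k)"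
proof (induction k)
  case (Suc k)
  have "(deriv ^^ k) f holomorphic_on UNIV"
    using assms by (intro holomorphic_higher_deriv) auto
  hence "(deriv ^^ k) f field_differentiable at z" for z
    by (simp add: holomorphic_on_imp_differentiable_at)
  hence "deriv (\<lambda>z. (deriv ^^ k) f z / (2 * of_real pi * \<i>) ^ k) z =
           (deriv ^^ Suc k) f z / (2 * of_real pi * \<i>) ^ k" for z
    by (subst deriv_cdivide_right) simp_all
  thus ?case
    unfolding funpow.simps(2) o_def Suc by (simp add: dz_def fun_eq_iff mult_ac)
qed simp

text \<open>Taylor's theorem for an entire \<open>f\<close>: the operator exponential is the
  translation by \<open>x / (2 * pi * i)\<close>.\<close>

lemma exp_x_dz_expansion:
  assumes "f holomorphic_on UNIV"
  shows "(\<lambda>x. f (z + x / (2 * of_real pi * \<i>))) has_fps_expansion exp_x_dz f z"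
proof (rule has_fps_expansionI, rule always_eventually, rule allI)
  fix x :: complex
  define h where "h = x / (2 * of_real pi * \<i>)"
  have "(\<lambda>n. (deriv ^^ n) f z / fact n * (z + h - z) ^ n) sums f (z + h)"
    using assms by (intro holomorphic_power_series[of _ _ "norm h + 1"])
      (auto intro: holomorphic_on_subset simp: dist_norm)
  thus "(\<lambda>n. fps_nth (exp_x_dz f z) n * x ^ n) sums f (z + x / (2 * of_real pi * \<i>))"
    by (simp add: exp_x_dz_def dz_power[OF assms] h_def power_divide mult_ac)
qed

lemma fps_divide_const:
  fixes F :: "'a :: field fps"
  shows "F / fps_const c = F * fps_const (inverse c)"
proof (cases "c = 0")
  case False
  thus ?thesis by (simp add: fps_divide_unit fps_const_inverse)
qed simp

text \<open>The coefficients of the theta side are viewed as functions of \<open>w\<close>. For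
  \<open>f = theta1\<close> they supply the continuation of \<open>J\<close>; for the other theta
  functions they are what the \<open>J\<close>-combinations are compared with.\<close>

definition theta_coeff :: "complex \<Rightarrow> (complex \<Rightarrow> complex) \<Rightarrow> nat \<Rightarrow> complex \<Rightarrow> complex" where
  "theta_coeff \<tau> f n w = fact n * fps_nth (theta1_prefactor \<tau> * (exp_x_dz f w / fps_const (f w))) n"

text \<open>From a finite sum of derivatives of \<open>f\<close> times \<open>inverse (f w)\<close>,
  analyticity off the zeros of \<open>f\<close> and meromorphy can be read off.\<close>

lemma theta_coeff_eq:
  "theta_coeff \<tau> f n w = fact n *
     (\<Sum>i=0..n. fps_nth (theta1_prefactor \<tau>) i * ((dz ^^ (n - i)) f w / fact (n - i) * inverse (f w)))"
  unfolding theta_coeff_def fps_divide_const fps_mult_nth[of "theta1_prefactor \<tau>"]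
  by (simp add: fps_mult_right_const_nth exp_x_dz_def)

lemma dz_power_holomorphic:
  assumes "f holomorphic_on UNIV"
  shows "(dz ^^ k) f holomorphic_on UNIV"
  unfolding dz_power[OF assms] using assms
  by (intro holomorphic_intros holomorphic_higher_deriv) auto

lemma theta_coeff_analytic:
  assumes "f holomorphic_on UNIV" "f w \<noteq> 0"
  shows "theta_coeff \<tau> f n analytic_on {w}"
proof -
  have *: "g analytic_on {w}" if "g holomorphic_on UNIV" for g
    using that by (metis analytic_on_open analytic_on_subset open_UNIV subset_UNIV)
  show ?thesis
    unfolding theta_coeff_eq using assms(2)
    by (intro analytic_intros * dz_power_holomorphic assms(1)) auto
qed

lemma theta_coeff_meromorphic:
  assumes "f holomorphic_on UNIV"
  shows "theta_coeff \<tau> f n meromorphic_on UNIV"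
proof -
  have *: "g meromorphic_on UNIV" if "g holomorphic_on UNIV" for g
    using that by (simp add: analytic_on_imp_meromorphic_on analytic_on_open)
  show ?thesis
    unfolding theta_coeff_eq
    by (intro meromorphic_intros * dz_power_holomorphic assms)
qed

text \<open>The series \<open>T\<close> has subdegree 1 with leading coefficient
  \<open>theta1_bullet 0 \<tau>\<close>, so it divides the numerator and the quotient can be cleared
  of its denominator.\<close>

lemma theta1_prefactor_times:
  assumes "Im \<tau> > 0"
  defines "T \<equiv> fps_expansion (\<lambda>x. theta1 (x / (2 * of_real pi * \<i>)) \<tau>) 0"
  shows "(\<lambda>x. theta1 (x / (2 * of_real pi * \<i>)) \<tau>) has_fps_expansion T"
    and "T \<noteq> 0" and "theta1_prefactor \<tau> * T = fps_X * fps_const (theta1_bullet 0 \<tau>)"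
proof -
  have E: "(\<lambda>x. theta1 (x / (2 * of_real pi * \<i>)) \<tau>) has_fps_expansion exp_x_dz (\<lambda>w. theta1 w \<tau>) 0"
    using exp_x_dz_expansion[OF theta1_holomorphic[OF assms(1)], of 0] by simp
  hence T: "T = exp_x_dz (\<lambda>w. theta1 w \<tau>) 0"
    unfolding T_def by (rule fps_expansion_eqI)
  show "(\<lambda>x. theta1 (x / (2 * of_real pi * \<i>)) \<tau>) has_fps_expansion T"
    using E T by simp
  have nz: "theta1_bullet 0 \<tau> \<noteq> 0"
    using deriv_theta1_0_nonzero[OF assms(1)] by (simp add: theta1_bullet_def dz_def)
  have T1: "fps_nth T 0 = 0" "fps_nth T 1 = theta1_bullet 0 \<tau>"
    by (simp_all add: T exp_x_dz_def theta1_bullet_def)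
  thus "T \<noteq> 0"
    using nz by auto
  have "subdegree T = 1"
    using T1 nz by (intro subdegreeI) auto
  hence "T dvd fps_X * fps_const (theta1_bullet 0 \<tau>)"
    using nz \<open>T \<noteq> 0\<close> by (subst fps_dvd_iff) auto
  thus "theta1_prefactor \<tau> * T = fps_X * fps_const (theta1_bullet 0 \<tau>)"
    unfolding theta1_prefactor_def T_def [symmetric] by simp
qed

text \<open>Multiplied by \<open>theta1\<close> and \<open>f w\<close>, both sides are the same
  function of \<open>x\<close> near 0. Uniqueness of expansions turns this into an identity of power
  series, from which the nonzero series \<open>T\<close> and the constant \<open>f w\<close> are
  cancelled.\<close>

lemma generating_function_eqI:
  fixes c :: "nat \<Rightarrow> complex"
  assumes tau: "Im \<tau> > 0" and f: "f holomorphic_on UNIV" "f w \<noteq> 0"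
    and sums: "\<forall>\<^sub>F x in at 0. (\<lambda>n. c n / fact n * x ^ n) sums (x * S x)"
    and S: "\<forall>\<^sub>F x in at 0. S x * theta1 (x / (2 * of_real pi * \<i>)) \<tau> * f w =
              theta1_bullet 0 \<tau> * f (w + x / (2 * of_real pi * \<i>))"
  shows "Abs_fps (\<lambda>n. c n / fact n) = theta1_prefactor \<tau> * (exp_x_dz f w / fps_const (f w))"
proof -
  define M where "M = Abs_fps (\<lambda>n. c n / fact n)"
  define T where "T = fps_expansion (\<lambda>x. theta1 (x / (2 * of_real pi * \<i>)) \<tau>) 0"
  note T = theta1_prefactor_times[OF tau, folded T_def]
  \<comment> \<open>The value at 0 has to be set to the constant term, since the product
    \<open>x * S x\<close> is 0 there even if \<open>S\<close> has a pole.\<close>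
  define m where "m = (\<lambda>x. if x = 0 then c 0 else x * S x)"
  have m: "m has_fps_expansion M"
  proof (rule has_fps_expansionI)
    show "\<forall>\<^sub>F x in nhds 0. (\<lambda>n. fps_nth M n * x ^ n) sums m x"
      unfolding eventually_nhds_conv_at
    proof
      show "\<forall>\<^sub>F x in at 0. (\<lambda>n. fps_nth M n * x ^ n) sums m x"
        using sums eventually_neq_at_within[of 0 0 UNIV]
        by eventually_elim (simp add: M_def m_def)
      show "(\<lambda>n. fps_nth M n * 0 ^ n) sums m 0"
        using powser_sums_zero[of "fps_nth M"] by (simp add: M_def m_def)
    qed
  qed
  have lhs: "(\<lambda>x. m x * theta1 (x / (2 * of_real pi * \<i>)) \<tau> * f w) has_fps_expansion M * T * fps_const (f w)"
    by (intro fps_expansion_intros m T(1))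
  have rhs: "(\<lambda>x. x * theta1_bullet 0 \<tau> * f (w + x / (2 * of_real pi * \<i>)))
      has_fps_expansion fps_X * fps_const (theta1_bullet 0 \<tau>) * exp_x_dz f w"
    by (intro has_fps_expansion_mult has_fps_expansion_fps_X has_fps_expansion_const exp_x_dz_expansion f)
  have "\<forall>\<^sub>F x in nhds 0. m x * theta1 (x / (2 * of_real pi * \<i>)) \<tau> * f w =
                    x * theta1_bullet 0 \<tau> * f (w + x / (2 * of_real pi * \<i>))"
    unfolding eventually_nhds_conv_at
  proof
    show "\<forall>\<^sub>F x in at 0. m x * theta1 (x / (2 * of_real pi * \<i>)) \<tau> * f w =
                    x * theta1_bullet 0 \<tau> * f (w + x / (2 * of_real pi * \<i>))"
      using S eventually_neq_at_within[of 0 0 UNIV]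
      by eventually_elim (simp add: m_def mult.assoc)
  qed auto
  from has_fps_expansion_cong[OF this refl] lhs
  have "(\<lambda>x. x * theta1_bullet 0 \<tau> * f (w + x / (2 * of_real pi * \<i>)))
      has_fps_expansion M * T * fps_const (f w)"
    by (simp only:)
  hence "M * T * fps_const (f w) = fps_X * fps_const (theta1_bullet 0 \<tau>) * exp_x_dz f w"
    using rhs by (rule fps_expansion_unique_complex)
  also have "\<dots> = theta1_prefactor \<tau> * exp_x_dz f w * T"
    by (simp add: T(3) [symmetric] mult_ac)
  finally have "M * fps_const (f w) * T = theta1_prefactor \<tau> * exp_x_dz f w * T"
    by (simp add: mult_ac)
  hence "M * fps_const (f w) = theta1_prefactor \<tau> * exp_x_dz f w"
    using T(2) by simp
  hence "M * fps_const (f w) * fps_const (inverse (f w)) =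
         theta1_prefactor \<tau> * exp_x_dz f w * fps_const (inverse (f w))"
    by simp
  also have "M * fps_const (f w) * fps_const (inverse (f w)) = M"
    using f(2) by (simp add: mult.assoc fps_const_mult)
  finally show ?thesis
    by (simp add: M_def fps_divide_const mult.assoc)
qed

section \<open>Uniqueness of meromorphic continuation\<close>

lemma nicely_meromorphic_remove_sings_eq:
  assumes "f nicely_meromorphic_on A" "z \<in> A"
  shows "remove_sings f z = f z"
  using assms unfolding nicely_meromorphic_on_def by (metis remove_sings_at_pole remove_sings_eqI)

text \<open>By the identity theorem \<open>f - g\<close>, with singularities removed, vanishes
  everywhere. So \<open>f\<close> and \<open>g\<close> agree on punctured neighbourhoods, and these
  determine the normalised values, poles included.\<close>

lemma nicely_meromorphic_eqI:
  assumes f: "f nicely_meromorphic_on UNIV" and g: "g nicely_meromorphic_on UNIV"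
    and A: "open A" "A \<noteq> {}" "\<And>w. w \<in> A \<Longrightarrow> f w = g w"
  shows "f = g"
proof
  fix z
  define h where "h = (\<lambda>w. f w - g w)"
  have h: "h meromorphic_on UNIV"
    using f g unfolding h_def nicely_meromorphic_on_def by (intro meromorphic_intros) auto
  obtain a where a: "a \<in> A"
    using A by blast
  have ev: "\<forall>\<^sub>F w in at x. w \<in> A" if "x \<in> A" for x
    using A(1) that by (intro eventually_at_in_open')
  have 0: "remove_sings h x = 0" if "x \<in> A" for x
  proof -
    have "remove_sings h x = remove_sings (\<lambda>_. 0) x"
      by (rule remove_sings_cong) (use ev[OF that] A(3) in \<open>auto elim!: eventually_mono simp: h_def\<close>)
    thus ?thesis by simp
  qed
  have "\<forall>\<^sub>F w in at a. remove_sings h w = 0"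
    using ev[OF a] by eventually_elim (rule 0)
  hence "\<exists>\<^sub>F w in at a. remove_sings h w = 0"
    by (intro eventually_frequently) auto
  hence "remove_sings h w = 0" for w
    by (rule frequently_eq_meromorphic_imp_constant[OF _ remove_sings_nicely_meromorphic[OF h]]) auto
  moreover have "\<forall>\<^sub>F w in at z. remove_sings h w = h w"
    using h by (intro eventually_remove_sings_eq_at meromorphic_on_isolated_singularity)
      (auto intro: meromorphic_on_subset)
  ultimately have "\<forall>\<^sub>F w in at z. f w = g w"
    by (auto elim: eventually_mono simp: h_def)
  hence "remove_sings f z = remove_sings g z"
    by (intro remove_sings_cong) auto
  thus "f z = g z"
    using f g by (simp add: nicely_meromorphic_remove_sings_eq)
qed

lemma eventually_theta1_scaled_nonzero:
  assumes "Im \<tau> > 0"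
  shows "\<forall>\<^sub>F x in at 0. theta1 (x / (2 * of_real pi * \<i>)) \<tau> \<noteq> 0"
proof -
  have "filterlim (\<lambda>x. x / (2 * of_real pi * \<i>)) (at 0) (at (0::complex))"
    by (rule filterlim_atI) (auto intro!: tendsto_eq_intros simp: eventually_at_filter)
  thus ?thesis
    using eventually_theta1_nonzero[OF assms] filterlim_iff by fast
qed

lemma nome_scaled: "nome (x / (2 * of_real pi * \<i>)) = exp x"
  by (simp add: nome_def)

lemma nome_root_scaled: "nome_root 2 (x / (2 * of_real pi * \<i>)) = exp (x / 2)"
  by (simp add: nome_root_def)

lemma eventually_kronecker_theta1:
  assumes "\<bar>Im z\<bar> < Im \<tau>" "z \<notin> \<int>"
  shows "\<forall>\<^sub>F x in at 0. kronecker (nome \<tau>) (nome z) (exp x) * theta1 (x / (2 * of_real pi * \<i>)) \<tau> *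
           theta1 z \<tau> = theta1_bullet 0 \<tau> * theta1 (z + x / (2 * of_real pi * \<i>)) \<tau>"
proof -
  have "Im \<tau> > 0"
    using assms by linarith
  from eventually_theta1_scaled_nonzero[OF this] show ?thesis
    by eventually_elim (use kronecker_theta1[OF assms] in \<open>simp only: nome_scaled [symmetric]\<close>)
qed

text \<open>The definite description in \<open>J\<close> is resolved here: by Kronecker's identity
  the theta coefficients of \<open>theta1\<close> provide a function as required, and the identity
  theorem on the strip without the integers excludes any other.\<close>

lemma J_meromorphic_continuation:
  assumes tau: "Im \<tau> > 0"
  shows "(\<lambda>z. J n z \<tau>) nicely_meromorphic_on UNIV"
    and "\<bar>Im z\<bar> < Im \<tau> \<Longrightarrow> z \<notin> \<int> \<Longrightarrow> J n z \<tau> = J_series n z \<tau>"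
proof -
  define P where "P = (\<lambda>f. f nicely_meromorphic_on UNIV \<and>
             (\<forall>w. \<bar>Im w\<bar> < Im \<tau> \<and> w \<notin> \<int> \<longrightarrow> f w = J_series n w \<tau>))"
  define f where "f = remove_sings (theta_coeff \<tau> (\<lambda>w. theta1 w \<tau>) n)"
  note hol = theta1_holomorphic[OF tau]
  have "f nicely_meromorphic_on UNIV"
    unfolding f_def by (intro remove_sings_nicely_meromorphic theta_coeff_meromorphic hol)
  moreover have "f w = J_series n w \<tau>" if w: "\<bar>Im w\<bar> < Im \<tau>" "w \<notin> \<int>" for w
  proof -
    note nz = theta1_nonzero_strip[OF w]
    have "Abs_fps (\<lambda>n. J_series n w \<tau> / fact n) =
            theta1_prefactor \<tau> * (exp_x_dz (\<lambda>w. theta1 w \<tau>) w / fps_const (theta1 w \<tau>))"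
      by (rule generating_function_eqI[OF tau hol nz J_series_sums[OF w(1)] eventually_kronecker_theta1[OF w]])
    from arg_cong[OF this, of "\<lambda>F. fact n * fps_nth F n"]
    have "theta_coeff \<tau> (\<lambda>w. theta1 w \<tau>) n w = J_series n w \<tau>"
      unfolding theta_coeff_def by (simp only: fps_nth_Abs_fps) simp
    thus ?thesis
      using theta_coeff_analytic[OF hol nz] by (simp add: f_def)
  qed
  ultimately have Pf: "P f"
    by (simp add: P_def)
  have "g = f" if "P g" for g
  proof (rule nicely_meromorphic_eqI)
    let ?A = "{w. \<bar>Im w\<bar> < Im \<tau>} - \<int>"
    show "open ?A"
      by (intro open_Diff open_Collect_less closed_Ints continuous_intros)
    have "\<tau> / 2 \<notin> \<int>"
    proof
      assume "\<tau> / 2 \<in> \<int>"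
      then obtain k where "\<tau> / 2 = of_int k"
        by (elim Ints_cases)
      from arg_cong[OF this, of Im] show False
        using tau by simp
    qed
    hence "\<tau> / 2 \<in> ?A"
      using tau by simp
    thus "?A \<noteq> {}"
      by blast
  qed (use that Pf in \<open>auto simp: P_def\<close>)
  with Pf have "(THE g. P g) = f"
    by (rule the_equality)
  hence eq: "(\<lambda>z. J n z \<tau>) = f"
    by (simp add: J_def P_def)
  show "(\<lambda>z. J n z \<tau>) nicely_meromorphic_on UNIV"
    using Pf unfolding eq by (simp add: P_def)
  show "\<bar>Im z\<bar> < Im \<tau> \<Longrightarrow> z \<notin> \<int> \<Longrightarrow> J n z \<tau> = J_series n z \<tau>"
    using Pf fun_cong[OF eq, of z] by (simp add: P_def)
qed

text \<open>Common frame for the three theta functions: \<open>L\<close> is the pointwise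
  combination of \<open>J\<close>-functions and \<open>x * S w x\<close> its generating function,
  known only for \<open>w\<close> in the open set \<open>A\<close>. Both \<open>L\<close> and the
  theta coefficients are meromorphic, so equality on \<open>A\<close> spreads; since
  \<open>f z \<noteq> 0\<close>, the latter are analytic at \<open>z\<close>.\<close>

lemma generating_function_continuation:
  assumes tau: "Im \<tau> > 0" and f: "f holomorphic_on UNIV" "f z \<noteq> 0"
    and L: "\<And>n. L n meromorphic_on UNIV" and A: "open A" "A \<noteq> {}"
    and nz: "\<And>w. w \<in> A \<Longrightarrow> f w \<noteq> 0"
    and sums: "\<And>w. w \<in> A \<Longrightarrow> \<forall>\<^sub>F x in at 0. (\<lambda>n. L n w / fact n * x ^ n) sums (x * S w x)"
    and S: "\<And>w. w \<in> A \<Longrightarrow> \<forall>\<^sub>F x in at 0. S w x * theta1 (x / (2 * of_real pi * \<i>)) \<tau> * f w =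
              theta1_bullet 0 \<tau> * f (w + x / (2 * of_real pi * \<i>))"
  shows "Abs_fps (\<lambda>n. remove_sings (L n) z / fact n) =
           theta1_prefactor \<tau> * (exp_x_dz f z / fps_const (f z))"
proof (rule fps_ext)
  fix n
  have L_eq: "L n w = theta_coeff \<tau> f n w" if "w \<in> A" for w
    using arg_cong[OF generating_function_eqI[OF tau f(1) nz[OF that] sums[OF that] S[OF that]],
        of "\<lambda>F. fact n * fps_nth F n"]
    unfolding theta_coeff_def by (simp only: fps_nth_Abs_fps) simp
  have "remove_sings (L n) = remove_sings (theta_coeff \<tau> f n)"
  proof (rule nicely_meromorphic_eqI[OF _ _ A])
    fix w assume "w \<in> A"
    hence "\<forall>\<^sub>F w in at w. w \<in> A"
      using A(1) by (intro eventually_at_in_open')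
    hence "\<forall>\<^sub>F w in at w. L n w = theta_coeff \<tau> f n w"
      by eventually_elim (rule L_eq)
    thus "remove_sings (L n) w = remove_sings (theta_coeff \<tau> f n) w"
      by (intro remove_sings_cong) auto
  qed (intro remove_sings_nicely_meromorphic L theta_coeff_meromorphic f(1))+
  hence "remove_sings (L n) z = theta_coeff \<tau> f n z"
    using theta_coeff_analytic[OF f] by simp
  thus "fps_nth (Abs_fps (\<lambda>n. remove_sings (L n) z / fact n)) n =
          fps_nth (theta1_prefactor \<tau> * (exp_x_dz f z / fps_const (f z))) n"
    by (simp only: theta_coeff_def) simp
qed

section \<open>Half-period shifts\<close>

lemma lambert_sums:
  assumes "norm q < 1" "norm (p * q) < 1"
  shows "(\<lambda>k. p ^ Suc k * (y * q ^ Suc k) / (1 - y * q ^ Suc k)) sums lambert q p y"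
  using lambert_summable[OF assms] unfolding lambert_def by (rule summable_sums)

lemma norm_mult_square_less_1:
  fixes p q :: complex
  assumes "norm (p * q) < 1"
  shows "norm (p ^ 2 * q ^ 2) < 1"
proof -
  have "norm (p ^ 2 * q ^ 2) = norm (p * q) ^ 2"
    by (simp add: norm_mult norm_power power_mult_distrib)
  also have "\<dots> < 1"
    using assms by (intro power_less_one_iff[THEN iffD2]) auto
  finally show ?thesis .
qed

text \<open>In the sum of the two series the odd powers of \<open>p\<close> cancel and the even ones
  double.\<close>

lemma lambert_uminus:
  assumes q: "norm q < 1" "norm (p * q) < 1"
  shows "lambert q (-p) y + lambert q p y = 2 * lambert (q ^ 2) (p ^ 2) y"
proof -
  have q': "norm (q ^ 2) < 1"
    using q by (simp add: norm_power power_less_one_iff)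
  define g where "g = (\<lambda>k. (p ^ 2) ^ Suc k * (y * (q ^ 2) ^ Suc k) / (1 - y * (q ^ 2) ^ Suc k))"
  have "g sums lambert (q ^ 2) (p ^ 2) y"
    unfolding g_def by (rule lambert_sums[OF q' norm_mult_square_less_1[OF q(2)]])
  hence "(\<lambda>j. 2 * g j) sums (2 * lambert (q ^ 2) (p ^ 2) y)"
    by (rule sums_mult)
  define f where "f = (\<lambda>k. (-p) ^ Suc k * (y * q ^ Suc k) / (1 - y * q ^ Suc k) +
                      p ^ Suc k * (y * q ^ Suc k) / (1 - y * q ^ Suc k))"
  have "f sums (lambert q (-p) y + lambert q p y)"
    unfolding f_def using q by (intro sums_add lambert_sums) auto
  also have "?this \<longleftrightarrow> (\<lambda>j. f (2 * j + 1)) sums (lambert q (-p) y + lambert q p y)"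
  proof (rule sums_mono_reindex [symmetric])
    \<comment> \<open>The term of index \<open>k\<close> carries the power \<open>Suc k\<close>, so
      the even indices belong to the odd powers.\<close>
    fix k :: nat assume "k \<notin> range (\<lambda>j. 2 * j + 1)"
    hence "even k"
      by (metis oddE rangeI)
    thus "f k = 0"
      by (simp add: f_def)
  qed (simp add: strict_mono_def)
  also have "(\<lambda>j. f (2 * j + 1)) = (\<lambda>j. 2 * g j)"
  proof
    fix j
    have "Suc (2 * j + 1) = 2 * Suc j"
      by simp
    thus "f (2 * j + 1) = 2 * g j"
      by (simp only: f_def g_def power_mult power2_minus) (simp only: mult_2)
  qed
  finally show ?thesis
    using \<open>(\<lambda>j. 2 * g j) sums _\<close> by (rule sums_unique2)
qed

text \<open>Replacing \<open>p\<close> by \<open>- p\<close> is the shift of \<open>z\<close> by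
  \<open>1 / 2\<close>. The relation between Lambert series is applied to both \<open>p\<close> and
  \<open>inverse p\<close>, and the rational terms satisfy the same relation.\<close>

lemma kronecker_uminus:
  assumes q: "norm q < 1" "norm (p * q) < 1" "norm (inverse p * q) < 1" and p: "p ^ 2 \<noteq> 1"
  shows "kronecker q (-p) y = 2 * kronecker (q ^ 2) (p ^ 2) y - kronecker q p y"
proof -
  have 1: "lambert q (-p) y + lambert q p y = 2 * lambert (q ^ 2) (p ^ 2) y"
    by (rule lambert_uminus[OF q(1,2)])
  have 2: "lambert q (inverse (-p)) (inverse y) + lambert q (inverse p) (inverse y) =
           2 * lambert (q ^ 2) (inverse (p ^ 2)) (inverse y)"
    using lambert_uminus[OF q(1,3), of "inverse y"] by (simp add: power_inverse)
  have "p - 1 \<noteq> 0" "p + 1 \<noteq> 0" "p ^ 2 - 1 \<noteq> 0" "-p - 1 \<noteq> 0"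
    using p by (auto simp: power2_eq_1_iff add_eq_0_iff minus_equation_iff[of p 1])
  hence 3: "(-p) / (-p - 1) + p / (p - 1) = 2 * (p ^ 2 / (p ^ 2 - 1))"
    by (simp add: divide_simps) (simp add: algebra_simps power2_eq_square)
  from 1 have u1: "lambert q (-p) y = 2 * lambert (q ^ 2) (p ^ 2) y - lambert q p y"
    by (simp add: algebra_simps)
  from 2 have u2: "lambert q (inverse (-p)) (inverse y) =
      2 * lambert (q ^ 2) (inverse (p ^ 2)) (inverse y) - lambert q (inverse p) (inverse y)"
    by (simp add: eq_diff_eq)
  from 3 have u3: "(-p) / (-p - 1) = 2 * (p ^ 2 / (p ^ 2 - 1)) - p / (p - 1)"
    by (simp add: eq_diff_eq)
  show ?thesis
    unfolding kronecker_def u1 u2 u3 by (simp add: algebra_simps)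
qed

text \<open>For \<open>norm p < 1\<close> also \<open>p / (p - 1)\<close> is a geometric series in
  \<open>p\<close>. Merged with the Lambert series it leaves a single series, which permits a
  comparison term by term.\<close>

lemma kronecker_sums:
  assumes q: "norm q < 1" "norm (p * q) < 1" "norm (inverse p * q) < 1" and p: "norm p < 1"
    and y: "\<And>k. y * q ^ Suc k \<noteq> 1"
  shows "(\<lambda>k. inverse p ^ Suc k * (inverse y * q ^ Suc k) / (1 - inverse y * q ^ Suc k)
              - p ^ Suc k / (1 - y * q ^ Suc k)) sums (kronecker q p y - 1 / (y - 1))"
proof -
  have "p \<noteq> 1"
    using p by auto
  have neg: "p * (1 / (1 - p)) = - (p / (p - 1))"
    using \<open>p \<noteq> 1\<close> by (simp add: divide_simps) (simp add: algebra_simps)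
  have "(\<lambda>k. p * p ^ k) sums (p * (1 / (1 - p)))"
    using p by (intro sums_mult geometric_sums)
  hence "(\<lambda>k. p ^ Suc k) sums (- (p / (p - 1)))"
    unfolding neg by simp
  hence "(\<lambda>k. inverse p ^ Suc k * (inverse y * q ^ Suc k) / (1 - inverse y * q ^ Suc k)
           - (p ^ Suc k + p ^ Suc k * (y * q ^ Suc k) / (1 - y * q ^ Suc k))) sums
         (lambert q (inverse p) (inverse y) - (- (p / (p - 1)) + lambert q p y))"
    using q by (intro sums_diff sums_add lambert_sums)
  also have "lambert q (inverse p) (inverse y) - (- (p / (p - 1)) + lambert q p y) =
               kronecker q p y - 1 / (y - 1)"
    by (simp add: kronecker_def)
  also have "(\<lambda>k. p ^ Suc k + p ^ Suc k * (y * q ^ Suc k) / (1 - y * q ^ Suc k)) =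
             (\<lambda>k. p ^ Suc k / (1 - y * q ^ Suc k))"
  proof
    fix k
    have "1 - y * q ^ Suc k \<noteq> 0"
      using y by (metis eq_iff_diff_eq_0)
    thus "p ^ Suc k + p ^ Suc k * (y * q ^ Suc k) / (1 - y * q ^ Suc k) = p ^ Suc k / (1 - y * q ^ Suc k)"
      by (simp add: divide_simps del: power_Suc) (simp add: algebra_simps)
  qed
  finally show ?thesis .
qed

text \<open>With \<open>u = v * s ^ (k + 1)\<close> the terms on both sides match because \<open>1 / (1 - u) - 1 / (1 - u\<^sup>2) = u / (1 - u\<^sup>2)\<close>.\<close>

lemma kronecker_half_period:
  assumes s: "s \<noteq> 0" "norm s < 1" and p: "p \<noteq> 0" "norm p < 1" "norm (inverse p * s) < 1"
    and v: "v \<noteq> 0" "\<And>m n. v ^ 2 * (s ^ 2) ^ m \<noteq> (s ^ 2) ^ n"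
  shows "v * kronecker (s ^ 2) (p * s) (v ^ 2) = kronecker s p v - kronecker (s ^ 2) p (v ^ 2)"
proof -
  have s2: "norm (s ^ 2) < 1"
    using s by (simp add: norm_power power_less_one_iff)
  have less: "norm (a * b) < 1" if "norm a < 1" "norm b < 1" for a b :: complex
    using that mult_left_mono[of "norm b" 1 "norm a"] by (simp add: norm_mult)
  have ps: "norm (p * s) < 1" "norm (p * s ^ 2) < 1" "norm (p * s * s ^ 2) < 1"
    using less s p(2) s2 by blast+
  have ps': "norm (inverse p * s ^ 2) < 1" "norm (inverse (p * s) * s ^ 2) < 1"
    using less[OF p(3) s(2)] p(3) s by (simp_all add: power2_eq_square field_simps)
  have nz1: "v ^ 2 * (s ^ 2) ^ Suc k \<noteq> 1" for k
    using v(2)[of "Suc k" 0] by simp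
  have nz2: "v * s ^ Suc k \<noteq> 1" for k
  proof
    assume "v * s ^ Suc k = 1"
    hence "(v * s ^ Suc k) ^ 2 = 1"
      by simp
    thus False
      using nz1[of k] by (simp only: power_mult_distrib power_mult [symmetric] mult.commute[of "Suc k"])
  qed
  have nz3: "inverse v ^ 2 * (s ^ 2) ^ Suc k \<noteq> 1" for k
    using v(2)[of 0 "Suc k"] v(1) by (auto simp: field_simps)
  define a where "a = (\<lambda>k. inverse (p * s) ^ Suc k * (inverse (v ^ 2) * (s ^ 2) ^ Suc k) /
        (1 - inverse (v ^ 2) * (s ^ 2) ^ Suc k) - (p * s) ^ Suc k / (1 - v ^ 2 * (s ^ 2) ^ Suc k))"
  define b where "b = (\<lambda>k. inverse p ^ Suc k * (inverse v * s ^ Suc k) /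
        (1 - inverse v * s ^ Suc k) - p ^ Suc k / (1 - v * s ^ Suc k))"
  define c where "c = (\<lambda>k. inverse p ^ Suc k * (inverse (v ^ 2) * (s ^ 2) ^ Suc k) /
        (1 - inverse (v ^ 2) * (s ^ 2) ^ Suc k) - p ^ Suc k / (1 - v ^ 2 * (s ^ 2) ^ Suc k))"
  have a: "a sums (kronecker (s ^ 2) (p * s) (v ^ 2) - 1 / (v ^ 2 - 1))"
    unfolding a_def by (intro kronecker_sums s2 ps ps' nz1)
  have b: "b sums (kronecker s p v - 1 / (v - 1))"
    unfolding b_def by (intro kronecker_sums s ps p nz2)
  have c: "c sums (kronecker (s ^ 2) p (v ^ 2) - 1 / (v ^ 2 - 1))"
    unfolding c_def by (intro kronecker_sums s2 ps ps' p nz1)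
  have abc: "v * a k = b k - c k" for k
  proof -
    define P S where "P = p ^ Suc k" and "S = s ^ Suc k"
    have nz: "P \<noteq> 0" "S \<noteq> 0"
      using p s by (simp_all add: P_def S_def)
    have S2: "(s ^ 2) ^ Suc k = S ^ 2"
      by (simp only: S_def power_mult [symmetric] mult.commute)
    define u w where "u = v * S" and "w = inverse v * S"
    have u2: "v ^ 2 * S ^ 2 = u ^ 2" and w2: "inverse (v ^ 2) * S ^ 2 = w ^ 2"
      by (simp_all add: u_def w_def power_mult_distrib power_inverse)
    have "u ^ 2 \<noteq> 1" "w ^ 2 \<noteq> 1"
      using nz1[of k] nz3[of k] u2 w2 S2 by (metis, metis power_inverse)
    hence nz': "1 - u \<noteq> 0" "1 - u ^ 2 \<noteq> 0" "1 - w \<noteq> 0" "1 - w ^ 2 \<noteq> 0"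
      by auto
    have "v * a k = inverse P * (v * inverse S * w ^ 2) / (1 - w ^ 2) - P * (v * S) / (1 - u ^ 2)"
      unfolding a_def S2 u2 w2 power_mult_distrib power_inverse P_def [symmetric] S_def [symmetric] 
      by (simp add: algebra_simps)
    \<comment> \<open>The factor \<open>v * inverse S\<close>, left over from \<open>v\<close> and
      the power of \<open>inverse s\<close>, cancels one of the two factors
      \<open>w = inverse v * S\<close>.\<close>
    also have "v * inverse S * w ^ 2 = w"
      using v(1) nz by (simp add: w_def power2_eq_square field_simps)
    also have "inverse P * w / (1 - w ^ 2) - P * (v * S) / (1 - u ^ 2) =
                 inverse P * (w / (1 - w ^ 2)) - P * (u / (1 - u ^ 2))"
      by (simp add: u_def)
    also have "w / (1 - w ^ 2) = w / (1 - w) - w ^ 2 / (1 - w ^ 2)"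
      using nz' by (simp add: divide_simps) (simp add: algebra_simps power2_eq_square)
    also have "u / (1 - u ^ 2) = 1 / (1 - u) - 1 / (1 - u ^ 2)"
      using nz' by (simp add: divide_simps) (simp add: algebra_simps power2_eq_square)
    also have "inverse P * (w / (1 - w) - w ^ 2 / (1 - w ^ 2)) - P * (1 / (1 - u) - 1 / (1 - u ^ 2)) = b k - c k"
      unfolding b_def c_def S2 u2 w2 power_inverse P_def [symmetric] S_def [symmetric]
        u_def [symmetric] w_def [symmetric]
      by (simp add: algebra_simps)
    finally show ?thesis .
  qed
  have "(\<lambda>k. v * a k) sums (v * (kronecker (s ^ 2) (p * s) (v ^ 2) - 1 / (v ^ 2 - 1)))"
    by (intro sums_mult a)
  moreover have "(\<lambda>k. v * a k) sums
      ((kronecker s p v - 1 / (v - 1)) - (kronecker (s ^ 2) p (v ^ 2) - 1 / (v ^ 2 - 1)))"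
    unfolding abc by (intro sums_diff b c)
  ultimately have eq: "v * (kronecker (s ^ 2) (p * s) (v ^ 2) - 1 / (v ^ 2 - 1)) =
      (kronecker s p v - 1 / (v - 1)) - (kronecker (s ^ 2) p (v ^ 2) - 1 / (v ^ 2 - 1))"
    by (rule sums_unique2)
  have "v ^ 2 \<noteq> 1"
    using v(2)[of 0 0] by simp
  hence "v ^ 2 - 1 \<noteq> 0" "v - 1 \<noteq> 0"
    by auto
  \<comment> \<open>The polar terms obey the identity used for the series, taken at
    \<open>u = v\<close> with opposite signs.\<close>
  hence "v / (v ^ 2 - 1) = 1 / (v - 1) - 1 / (v ^ 2 - 1)"
    by (simp add: divide_simps) (simp add: algebra_simps power2_eq_square)
  with eq show ?thesis
    by (simp add: algebra_simps)
qed

section \<open>Transfer to the combinations of \<open>J\<close>\<close>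

lemma not_Ints_Im: "Im z \<noteq> 0 \<Longrightarrow> z \<notin> \<int>"
  by (auto elim: Ints_cases)

lemma J_meromorphic_compose:
  assumes "Im \<tau> > 0" "g holomorphic_on UNIV"
  shows "(\<lambda>z. J n (g z) \<tau>) meromorphic_on UNIV"
  using J_meromorphic_continuation(1)[OF assms(1), of n] assms(2)
  by (intro meromorphic_on_compose[of "\<lambda>z. J n z \<tau>" UNIV g])
    (auto simp: nicely_meromorphic_on_def analytic_on_open)

lemma J_sums:
  assumes "0 < Im z" "Im z < Im \<tau>"
  shows "\<forall>\<^sub>F x in at 0. (\<lambda>n. J n z \<tau> / fact n * x ^ n) sums (x * kronecker (nome \<tau>) (nome z) (exp x))"
proof -
  have "J n z \<tau> = J_series n z \<tau>" for n
    using assms not_Ints_Im[of z] by (intro J_meromorphic_continuation) auto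
  thus ?thesis
    using J_series_sums[of z \<tau>] assms by simp
qed

text \<open>Replacing \<open>x\<close> by \<open>x / 2\<close> gives the powers
  \<open>2 powi (- n)\<close>; the extra factor 2 restores the prefactor \<open>x\<close>.\<close>

lemma J_sums_half:
  assumes "0 < Im z" "Im z < Im \<tau>"
  shows "\<forall>\<^sub>F x in at 0. (\<lambda>n. 2 powi (1 - int n) * J n z \<tau> / fact n * x ^ n) sums
           (x * kronecker (nome \<tau>) (nome z) (exp (x / 2)))"
proof -
  have "filterlim (\<lambda>x. x / 2) (at 0) (at (0::complex))"
    by (rule filterlim_atI) (auto intro!: tendsto_eq_intros simp: eventually_at_filter)
  hence "\<forall>\<^sub>F x in at 0. (\<lambda>n. J n z \<tau> / fact n * (x / 2) ^ n) sums
           (x / 2 * kronecker (nome \<tau>) (nome z) (exp (x / 2)))"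
    using J_sums[OF assms] filterlim_iff by fast
  thus ?thesis
  proof eventually_elim
    case (elim x)
    from sums_mult[OF this, of 2] show ?case
      by (simp add: power_int_diff power_divide field_simps)
  qed
qed

lemma theta1_comp_holomorphic:
  assumes "Im \<tau> > 0" "g holomorphic_on UNIV"
  shows "(\<lambda>z. theta1 (g z) \<tau>) holomorphic_on UNIV"
  using holomorphic_on_compose_gen[OF assms(2) theta1_holomorphic[OF assms(1)]] by (simp add: o_def)

lemma theta_holomorphic:
  assumes "Im \<tau> > 0"
  shows "(\<lambda>z. theta i z \<tau>) holomorphic_on UNIV"
  unfolding theta_def theta2_def theta3_def theta4_def
  using assms by (cases "i = 2"; cases "i = 3"; cases "i = 4")
    (auto intro!: holomorphic_intros theta1_comp_holomorphic)

lemma theta3_conv_theta1: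
  "theta3 z \<tau> = nome_root 8 \<tau> * nome_root 2 z * theta1 (z + 1 / 2 + \<tau> / 2) \<tau>"
  by (simp add: theta3_def add_ac)

text \<open>The two shifts by \<open>1 / 2\<close> add up to a full period, which costs the
  sign.\<close>

lemma theta4_conv_theta1:
  "theta4 z \<tau> = - nome_root 8 \<tau> * nome_root 2 (z + 1 / 2) * theta1 (z + \<tau> / 2) \<tau>"
  using theta1_add_1[of "z + \<tau> / 2" \<tau>] by (simp add: theta4_def theta3_def add_ac)

text \<open>On this strip the defining double series is available for every term: at
  \<open>w\<close> with \<open>\<tau> / 2\<close> or \<open>\<tau>\<close>, and at
  \<open>2 * w\<close> with \<open>\<tau>\<close> or \<open>2 * \<tau>\<close>. Also
  \<open>w + \<tau> / 2\<close> stays in the strip of Kronecker's identity, and positive imaginary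
  parts avoid the integers.\<close>

definition half_strip :: "complex \<Rightarrow> complex set" where
  "half_strip \<tau> = {w. 0 < Im w \<and> Im w < Im \<tau> / 2}"

lemma half_strip_open: "open (half_strip \<tau>)"
  unfolding half_strip_def by (intro open_Collect_conj open_Collect_less continuous_intros)

lemma half_strip_nonempty:
  assumes "Im \<tau> > 0"
  shows "half_strip \<tau> \<noteq> {}"
proof -
  have "\<tau> / 4 \<in> half_strip \<tau>"
    using assms by (simp add: half_strip_def)
  thus ?thesis by blast
qed

text \<open>The square roots are \<open>s = nome (\<tau> / 2)\<close> and
  \<open>v = exp (x / 2)\<close>; the nonvanishing of \<open>theta1\<close> keeps
  \<open>v ^ 2\<close> off the powers of \<open>nome \<tau>\<close>.\<close>

lemma kronecker_nome_half_period:
  assumes tau: "Im \<tau> > 0" and w: "w \<in> half_strip \<tau>"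
    and x: "theta1 (x / (2 * of_real pi * \<i>)) \<tau> \<noteq> 0"
  shows "exp (x / 2) * kronecker (nome \<tau>) (nome (w + \<tau> / 2)) (exp x) =
           kronecker (nome (\<tau> / 2)) (nome w) (exp (x / 2)) - kronecker (nome \<tau>) (nome w) (exp x)"
proof -
  have tau2: "nome \<tau> = nome (\<tau> / 2) ^ 2"
    using nome_double[of "\<tau> / 2"] by simp
  have x2: "exp x = exp (x / 2) ^ 2"
    by (simp add: exp_double [symmetric])
  have "norm (inverse (nome w) * nome (\<tau> / 2)) < 1"
    using w by (intro norm_nome_strip) (auto simp: half_strip_def)
  moreover have "norm (nome (\<tau> / 2)) < 1" "norm (nome w) < 1"
    using w tau by (auto intro!: norm_nome_less_1 simp: half_strip_def)
  moreover have "exp (x / 2) ^ 2 * (nome (\<tau> / 2) ^ 2) ^ m \<noteq> (nome (\<tau> / 2) ^ 2) ^ n" for m n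
    unfolding tau2 [symmetric] x2 [symmetric]
    using theta1_nonzeroD[OF tau x, of m n] by (simp add: nome_scaled)
  ultimately show ?thesis
    unfolding nome_add tau2 x2 by (intro kronecker_half_period) auto
qed

lemma kronecker_nome_half:
  assumes "0 < Im w" "Im w < Im \<tau>"
  shows "kronecker (nome \<tau>) (nome (w + 1 / 2)) y =
           2 * kronecker (nome (2 * \<tau>)) (nome (2 * w)) y - kronecker (nome \<tau>) (nome w) y"
proof -
  have "nome w ^ 2 \<noteq> 1"
    using assms not_Ints_Im[of "2 * w"] by (simp add: nome_double [symmetric] nome_eq_1_iff)
  thus ?thesis
    using kronecker_uminus[of "nome \<tau>" "nome w" y] norm_nome_strip[of w \<tau>]
      norm_nome_less_1[of \<tau>] assms
    by (simp add: nome_add nome_double)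
qed

text \<open>Kronecker's identity is applied at \<open>w + 1 / 2\<close>; the sign change of
  \<open>p\<close> splits Kronecker's function into the two \<open>J\<close>-terms.\<close>

theorem J2_generating_function:
  assumes tau: "Im \<tau> > 0" and nz: "theta2 z \<tau> \<noteq> 0"
  shows "Abs_fps (\<lambda>n. J2 n z \<tau> / fact n) =
           theta1_prefactor \<tau> * (exp_x_dz (\<lambda>w. theta2 w \<tau>) z / fps_const (theta2 z \<tau>))"
  unfolding J2_def
proof (rule generating_function_continuation[where f = "\<lambda>w. theta2 w \<tau>" and A = "half_strip \<tau>" and
        L = "\<lambda>n w. 2 * J n (2 * w) (2 * \<tau>) - J n w \<tau>" and
        S = "\<lambda>w x. kronecker (nome \<tau>) (nome (w + 1 / 2)) (exp x)"])
  show "(\<lambda>w. theta2 w \<tau>) holomorphic_on UNIV"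
    using theta_holomorphic[OF tau, of 2] by (simp add: theta_def)
  show "(\<lambda>w. 2 * J n (2 * w) (2 * \<tau>) - J n w \<tau>) meromorphic_on UNIV" for n
    using tau by (intro meromorphic_intros J_meromorphic_compose holomorphic_intros) auto
next
  fix w assume "w \<in> half_strip \<tau>"
  hence w: "0 < Im w" "Im w < Im \<tau>"
    using tau by (auto simp: half_strip_def)
  have w': "\<bar>Im (w + 1 / 2)\<bar> < Im \<tau>" "w + 1 / 2 \<notin> \<int>"
    using w by (auto intro!: not_Ints_Im)
  show "theta2 w \<tau> \<noteq> 0"
    unfolding theta2_def by (rule theta1_nonzero_strip[OF w'])
  show "\<forall>\<^sub>F x in at 0. kronecker (nome \<tau>) (nome (w + 1 / 2)) (exp x) *
          theta1 (x / (2 * of_real pi * \<i>)) \<tau> * theta2 w \<tau> =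
          theta1_bullet 0 \<tau> * theta2 (w + x / (2 * of_real pi * \<i>)) \<tau>"
    using eventually_kronecker_theta1[OF w'] by (simp add: theta2_def add_ac)
  have "\<forall>\<^sub>F x in at 0. (\<lambda>n. J n (2 * w) (2 * \<tau>) / fact n * x ^ n) sums
          (x * kronecker (nome (2 * \<tau>)) (nome (2 * w)) (exp x))"
    using w by (intro J_sums) auto
  moreover have "\<forall>\<^sub>F x in at 0. (\<lambda>n. J n w \<tau> / fact n * x ^ n) sums
          (x * kronecker (nome \<tau>) (nome w) (exp x))"
    using w by (intro J_sums)
  ultimately show "\<forall>\<^sub>F x in at 0. (\<lambda>n. (2 * J n (2 * w) (2 * \<tau>) - J n w \<tau>) / fact n * x ^ n) sums
          (x * kronecker (nome \<tau>) (nome (w + 1 / 2)) (exp x))"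
  proof eventually_elim
    case (elim x)
    from sums_diff[OF sums_mult[OF elim(1), of 2] elim(2)] show ?case
      unfolding kronecker_nome_half[OF w] by (simp add: algebra_simps diff_divide_distrib)
  qed
qed (fact tau nz half_strip_open half_strip_nonempty[OF tau])+

text \<open>Kronecker's identity is applied at \<open>w + \<tau> / 2\<close>. Under translation the
  square root of \<open>p\<close> in \<open>theta4\<close> contributes \<open>exp (x / 2)\<close>,
  which is the factor \<open>v\<close> of the half-period relation.\<close>

theorem J4_generating_function:
  assumes tau: "Im \<tau> > 0" and nz: "theta4 z \<tau> \<noteq> 0"
  shows "Abs_fps (\<lambda>n. J4 n z \<tau> / fact n) =
           theta1_prefactor \<tau> * (exp_x_dz (\<lambda>w. theta4 w \<tau>) z / fps_const (theta4 z \<tau>))"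
  unfolding J4_def
proof (rule generating_function_continuation[where f = "\<lambda>w. theta4 w \<tau>" and A = "half_strip \<tau>" and
        L = "\<lambda>n w. 2 powi (1 - int n) * J n w (\<tau> / 2) - J n w \<tau>" and
        S = "\<lambda>w x. exp (x / 2) * kronecker (nome \<tau>) (nome (w + \<tau> / 2)) (exp x)"])
  show "(\<lambda>w. theta4 w \<tau>) holomorphic_on UNIV"
    using theta_holomorphic[OF tau, of 4] by (simp add: theta_def)
  show "(\<lambda>w. 2 powi (1 - int n) * J n w (\<tau> / 2) - J n w \<tau>) meromorphic_on UNIV" for n
    using tau by (intro meromorphic_intros J_meromorphic_compose holomorphic_intros) auto
next
  fix w assume half: "w \<in> half_strip \<tau>"
  hence w: "0 < Im w" "Im w < Im \<tau>" "Im w < Im (\<tau> / 2)"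
    using tau by (auto simp: half_strip_def)
  have w': "\<bar>Im (w + \<tau> / 2)\<bar> < Im \<tau>" "w + \<tau> / 2 \<notin> \<int>"
    using w by (auto intro!: not_Ints_Im)
  show "theta4 w \<tau> \<noteq> 0"
    unfolding theta4_conv_theta1 using theta1_nonzero_strip[OF w'] by simp
  show "\<forall>\<^sub>F x in at 0. exp (x / 2) * kronecker (nome \<tau>) (nome (w + \<tau> / 2)) (exp x) *
          theta1 (x / (2 * of_real pi * \<i>)) \<tau> * theta4 w \<tau> =
          theta1_bullet 0 \<tau> * theta4 (w + x / (2 * of_real pi * \<i>)) \<tau>"
    using eventually_kronecker_theta1[OF w']
  proof eventually_elim
    case (elim x)
    define h where "h = x / (2 * of_real pi * \<i>)"
    have "nome_root 2 h = exp (x / 2)"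
      by (simp add: h_def nome_root_scaled)
    hence "theta1_bullet 0 \<tau> * theta4 (w + h) \<tau> = - nome_root 8 \<tau> * nome_root 2 (w + 1 / 2) * exp (x / 2) *
             (theta1_bullet 0 \<tau> * theta1 (w + \<tau> / 2 + h) \<tau>)"
      by (simp add: theta4_conv_theta1 nome_root_add add_ac)
    also have "\<dots> = exp (x / 2) * kronecker (nome \<tau>) (nome (w + \<tau> / 2)) (exp x) * theta1 h \<tau> * theta4 w \<tau>"
      unfolding elim [folded h_def, symmetric] theta4_conv_theta1 by (simp add: mult_ac)
    finally show ?case
      by (simp add: h_def)
  qed
  have "\<forall>\<^sub>F x in at 0. (\<lambda>n. 2 powi (1 - int n) * J n w (\<tau> / 2) / fact n * x ^ n) sums
          (x * kronecker (nome (\<tau> / 2)) (nome w) (exp (x / 2)))"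
    using w by (intro J_sums_half)
  moreover have "\<forall>\<^sub>F x in at 0. (\<lambda>n. J n w \<tau> / fact n * x ^ n) sums
          (x * kronecker (nome \<tau>) (nome w) (exp x))"
    using w by (intro J_sums)
  ultimately show "\<forall>\<^sub>F x in at 0. (\<lambda>n. (2 powi (1 - int n) * J n w (\<tau> / 2) - J n w \<tau>) / fact n * x ^ n) sums
          (x * (exp (x / 2) * kronecker (nome \<tau>) (nome (w + \<tau> / 2)) (exp x)))"
    using eventually_theta1_scaled_nonzero[OF tau]
  proof eventually_elim
    case (elim x)
    from sums_diff[OF elim(1,2)] show ?case
      unfolding kronecker_nome_half_period[OF tau half elim(3)]
      by (simp add: algebra_simps diff_divide_distrib)
  qed
qed (fact tau nz half_strip_open half_strip_nonempty[OF tau])+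

text \<open>Both half periods are combined. The half-period relation at \<open>w + 1 / 2\<close>
  gives two Kronecker functions, and the shift by \<open>1 / 2\<close> splits each again: the one
  for \<open>\<tau> / 2\<close> into the first and last \<open>J\<close>-terms, the one for
  \<open>\<tau>\<close> into the middle two.\<close>

theorem J3_generating_function:
  assumes tau: "Im \<tau> > 0" and nz: "theta3 z \<tau> \<noteq> 0"
  shows "Abs_fps (\<lambda>n. J3 n z \<tau> / fact n) =
           theta1_prefactor \<tau> * (exp_x_dz (\<lambda>w. theta3 w \<tau>) z / fps_const (theta3 z \<tau>))"
  unfolding J3_def
proof (rule generating_function_continuation[where f = "\<lambda>w. theta3 w \<tau>" and A = "half_strip \<tau>" and
        L = "\<lambda>n w. 2 powi (2 - int n) * J n (2 * w) \<tau> - 2 * J n (2 * w) (2 * \<tau>)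
             + J n w \<tau> - 2 powi (1 - int n) * J n w (\<tau> / 2)" and
        S = "\<lambda>w x. exp (x / 2) * kronecker (nome \<tau>) (nome (w + 1 / 2 + \<tau> / 2)) (exp x)"])
  show "(\<lambda>w. theta3 w \<tau>) holomorphic_on UNIV"
    using theta_holomorphic[OF tau, of 3] by (simp add: theta_def)
  show "(\<lambda>w. 2 powi (2 - int n) * J n (2 * w) \<tau> - 2 * J n (2 * w) (2 * \<tau>)
               + J n w \<tau> - 2 powi (1 - int n) * J n w (\<tau> / 2)) meromorphic_on UNIV" for n
    using tau by (intro meromorphic_intros J_meromorphic_compose holomorphic_intros) auto
next
  fix w assume "w \<in> half_strip \<tau>"
  hence half: "w + 1 / 2 \<in> half_strip \<tau>" and w: "0 < Im w" "Im w < Im \<tau>" "Im w < Im (\<tau> / 2)"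
    using tau by (auto simp: half_strip_def)
  have w': "\<bar>Im (w + 1 / 2 + \<tau> / 2)\<bar> < Im \<tau>" "w + 1 / 2 + \<tau> / 2 \<notin> \<int>"
    using w by (auto intro!: not_Ints_Im)
  show "theta3 w \<tau> \<noteq> 0"
    unfolding theta3_conv_theta1 using theta1_nonzero_strip[OF w'] by simp
  show "\<forall>\<^sub>F x in at 0. exp (x / 2) * kronecker (nome \<tau>) (nome (w + 1 / 2 + \<tau> / 2)) (exp x) *
          theta1 (x / (2 * of_real pi * \<i>)) \<tau> * theta3 w \<tau> =
          theta1_bullet 0 \<tau> * theta3 (w + x / (2 * of_real pi * \<i>)) \<tau>"
    using eventually_kronecker_theta1[OF w']
  proof eventually_elim
    case (elim x)
    define h where "h = x / (2 * of_real pi * \<i>)"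
    have "nome_root 2 h = exp (x / 2)"
      by (simp add: h_def nome_root_scaled)
    hence "theta1_bullet 0 \<tau> * theta3 (w + h) \<tau> = nome_root 8 \<tau> * nome_root 2 w * exp (x / 2) *
             (theta1_bullet 0 \<tau> * theta1 (w + 1 / 2 + \<tau> / 2 + h) \<tau>)"
      by (simp add: theta3_conv_theta1 nome_root_add add_ac)
    also have "\<dots> = exp (x / 2) * kronecker (nome \<tau>) (nome (w + 1 / 2 + \<tau> / 2)) (exp x) * theta1 h \<tau> * theta3 w \<tau>"
      unfolding elim [folded h_def, symmetric] theta3_conv_theta1 by (simp add: mult_ac)
    finally show ?case
      by (simp add: h_def)
  qed
  have "\<forall>\<^sub>F x in at 0. (\<lambda>n. 2 powi (1 - int n) * J n (2 * w) \<tau> / fact n * x ^ n) sums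
          (x * kronecker (nome \<tau>) (nome (2 * w)) (exp (x / 2)))"
    using w by (intro J_sums_half) auto
  moreover have "\<forall>\<^sub>F x in at 0. (\<lambda>n. J n (2 * w) (2 * \<tau>) / fact n * x ^ n) sums
          (x * kronecker (nome (2 * \<tau>)) (nome (2 * w)) (exp x))"
    using w by (intro J_sums) auto
  moreover have "\<forall>\<^sub>F x in at 0. (\<lambda>n. J n w \<tau> / fact n * x ^ n) sums
          (x * kronecker (nome \<tau>) (nome w) (exp x))"
    using w by (intro J_sums)
  moreover have "\<forall>\<^sub>F x in at 0. (\<lambda>n. 2 powi (1 - int n) * J n w (\<tau> / 2) / fact n * x ^ n) sums
          (x * kronecker (nome (\<tau> / 2)) (nome w) (exp (x / 2)))"
    using w by (intro J_sums_half)
  ultimately show "\<forall>\<^sub>F x in at 0. (\<lambda>n. (2 powi (2 - int n) * J n (2 * w) \<tau> - 2 * J n (2 * w) (2 * \<tau>)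
               + J n w \<tau> - 2 powi (1 - int n) * J n w (\<tau> / 2)) / fact n * x ^ n) sums
          (x * (exp (x / 2) * kronecker (nome \<tau>) (nome (w + 1 / 2 + \<tau> / 2)) (exp x)))"
    using eventually_theta1_scaled_nonzero[OF tau]
  proof eventually_elim
    case (elim x)
    have "2 powi (2 - int n) = 2 * (2 powi (1 - int n) :: complex)" for n
      by (simp add: power_int_diff)
    with sums_diff[OF sums_add[OF sums_diff[OF sums_mult[OF elim(1), of 2] sums_mult[OF elim(2), of 2]] elim(3)] elim(4)]
    show ?case
      unfolding kronecker_nome_half_period[OF tau half elim(5)]
        kronecker_nome_half[OF w(1,2)] kronecker_nome_half[OF w(1,3)]
      by (simp add: algebra_simps diff_divide_distrib add_divide_distrib)
  qed
qed (fact tau nz half_strip_open half_strip_nonempty[OF tau])+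

theorem theorem3p4:
  fixes i :: nat and z \<tau> :: complex
  assumes "Im \<tau> > 0"
    and "i \<in> {2, 3, 4}"
    and "theta i z \<tau> \<noteq> 0"
  shows "Abs_fps (\<lambda>n. J_sub i n z \<tau> / fact n) =
    theta1_prefactor \<tau> * (exp_x_dz (\<lambda>w. theta i w \<tau>) z / fps_const (theta i z \<tau>))"
  using assms J2_generating_function[of \<tau> z] J3_generating_function[of \<tau> z] J4_generating_function[of \<tau> z]
  by (auto simp: J_sub_def theta_def)

end
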